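(* Let $n,m,p\ge 1$ and $1\le r<n$ be integers, let $k>0$ and $T>0$ be constants, and let $A,N_1,\dots,N_m\in\mathbb{R}^{n\times n}$, $B\in\mathbb{R}^{n\times m}$, $C\in\mathbb{R}^{p\times n}$. Assume that $$\sigma\Big(I_n\otimes (A+\tfrac{k^2}{2} I_n)+(A+\tfrac{k^2}{2} I_n)\otimes I_n+\sum_{i=1}^m N_i\otimes N_i\Big)\subset \mathbb{C}_-.$$ Let $\Sigma=\operatorname{diag}(\sigma_1,\dots,\sigma_n)$ with $\sigma_1\ge\dots\ge\sigma_n>0$ satisfy (the system is balanced with respect to its type II Gramians, i.e. $P=Q=\Sigma$) $$(A+\tfrac{k^2}{2} I_n)^T \Sigma^{-1}+\Sigma^{-1}(A+\tfrac{k^2}{2}I_n)+\sum_{i=1}^m N_i^T \Sigma^{-1} N_i \leq -\Sigma^{-1}BB^T \Sigma^{-1},$$ $$(A+\tfrac{k^2}{2} I_n)^T \Sigma+\Sigma (A+\tfrac{k^2}{2} I_n)+\sum_{i=1}^m N_i^T \Sigma N_i \leq -C^T C.$$ Write $\Sigma=\operatorname{diag}(\Sigma_1,\Sigma_2)$ with $\Sigma_1=\operatorname{diag}(\sigma_1,\dots,\sigma_r)$ and $\Sigma_2=\operatorname{diag}(\sigma_{r+1},\dots,\sigma_n)$, and let $\tilde\sigma_1,\dots,\tilde\sigma_\nu$ be the distinct diagonal entries of $\Sigma_2$, so that $\Sigma_2=\operatorname{diag}(\tilde\sigma_1 I,\tilde\sigma_2 I,\dots,\tilde\sigma_\nu I)$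 with identity blocks of appropriate sizes. Partition $$A=\begin{bmatrix} A_{11} & A_{12} \\ {} A_{21} & A_{22} \end{bmatrix},\quad B=\begin{bmatrix} B_1 \\ {} B_2 \end{bmatrix},\quad N_i=\begin{bmatrix} N_{i,11} & N_{i,12} \\ {} N_{i,21} & N_{i,22} \end{bmatrix},\quad C=\begin{bmatrix} C_1 & C_2 \end{bmatrix}$$ with $A_{11},N_{i,11}\in\mathbb{R}^{r\times r}$, $B_1\in\mathbb{R}^{r\times m}$, $C_1\in\mathbb{R}^{p\times r}$. Let $u=(u_1,\dots,u_m)^T$ be a control with $\|u(t)\|_2\le k$ for $t\in[0,T]$. Let $y$ be the output of the full system $$\frac{dx(t)}{dt}=Ax(t)+Bu(t)+\sum_{i=1}^m N_i x(t)u_i(t),\quad x(0)=0,\qquad y(t)=Cx(t),$$ and let $y_r$ be the output of the reduced order model $$\frac{dx_r(t)}{dt}=A_{11}x_r(t)+B_1u(t)+\sum_{i=1}^m N_{i,11} x_r(t)u_i(t),\quad x_r(0)=0,\qquad y_r(t)=C_1x_r(t).$$ Then $$\|y-y_r\|_{L^2_T}\leq 2(\tilde\sigma_{1}+\tilde\sigma_{2}+\dots+\tilde\sigma_\nu)\,\|u\|_{L^2_T}.$$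
   Context: For a (vector-valued, measurable) function $f$ on $[0,T]$, $\|f\|_{L^2_T}^2:=\int_0^T\|f(t)\|_2^2\,dt$, where $\|\cdot\|_2$ is the Euclidean norm. Controls $u$ are $L^2_T$ functions. For symmetric matrices, $M_1\le M_2$ means that $M_2-M_1$ is positive semidefinite. $\sigma(\cdot)$ applied to a matrix denotes its spectrum, $\mathbb{C}_-$ the open left half-plane, $\otimes$ the Kronecker product, $I_n$ the $n\times n$ identity. The numbers $\sigma_1,\dots,\sigma_n$ are called the Hankel singular values; the reduced order model is called the type II balanced truncation model. *)

theory Defs
  imports
    "HOL-Analysis.Analysis"
    "Jordan_Normal_Form.Matrix"
    "Jordan_Normal_Form.Gauss_Jordan_Elimination"
    "Jordan_Normal_Form.Spectral_Radius"
begin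

unbundle no vec_syntax
no_notation inner (infix \<open>\<bullet>\<close> 70)

text \<open>
  Vectors and matrices are those of \<^theory>\<open>Jordan_Normal_Form.Matrix\<close>, with explicit
  dimensions. All indices start at 0, so the informal \<open>\<sigma>\<^sub>1, \<dots>, \<sigma>\<^sub>n\<close> are
  \<open>\<sigma> 0, \<dots>, \<sigma> (n - 1)\<close>.
\<close>


section \<open>Matrices\<close>

definition kronecker :: "'a :: times mat \<Rightarrow> 'a mat \<Rightarrow> 'a mat" (infixl \<open>\<otimes>\<^sub>m\<close> 70) where
  "A \<otimes>\<^sub>m B = mat (dim_row A * dim_row B) (dim_col A * dim_col B)
     (\<lambda>(i, j). A $$ (i div dim_row B, j div dim_col B) * B $$ (i mod dim_row B, j mod dim_col B))"

text \<open>Unlike \<^const>\<open>sum_mat\<close>, which adds up the entries of one matrix, this is the sum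
  of the \<open>nr \<times> nc\<close> matrices \<open>F 0, \<dots>, F (m - 1)\<close>.\<close>

definition mat_sum :: "nat \<Rightarrow> nat \<Rightarrow> (nat \<Rightarrow> 'a :: comm_monoid_add mat) \<Rightarrow> nat \<Rightarrow> 'a mat" where
  "mat_sum nr nc F m = mat nr nc (\<lambda>(a, b). \<Sum>i<m. F i $$ (a, b))"

definition append_cols :: "'a :: zero mat \<Rightarrow> 'a mat \<Rightarrow> 'a mat" (infixr \<open>@\<^sub>c\<close> 65) where
  "A @\<^sub>c B = four_block_mat A B (0\<^sub>m 0 (dim_col A)) (0\<^sub>m 0 (dim_col B))"

definition symmetric_mat :: "nat \<Rightarrow> real mat \<Rightarrow> bool" where
  "symmetric_mat n M \<longleftrightarrow> M \<in> carrier_mat n n \<and> transpose_mat M = M"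

definition psd_mat :: "nat \<Rightarrow> real mat \<Rightarrow> bool" where
  "psd_mat n M \<longleftrightarrow> symmetric_mat n M \<and> (\<forall>v \<in> carrier_vec n. 0 \<le> v \<bullet> (M *\<^sub>v v))"

text \<open>The Loewner order; the \<open>\<le>\<close> of \<^theory>\<open>Jordan_Normal_Form.Matrix\<close> is the entrywise order.\<close>

definition loewner_le :: "nat \<Rightarrow> real mat \<Rightarrow> real mat \<Rightarrow> bool" where
  "loewner_le n M1 M2 \<longleftrightarrow> symmetric_mat n M1 \<and> symmetric_mat n M2 \<and> psd_mat n (M2 - M1)"


section \<open>Square integrable functions on $[0,T]$\<close>

definition eucl_norm :: "real vec \<Rightarrow> real" where
  "eucl_norm v = sqrt (v \<bullet> v)"

definition square_integrable :: "nat \<Rightarrow> real \<Rightarrow> (real \<Rightarrow> real vec) \<Rightarrow> bool" where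
  "square_integrable d T f \<longleftrightarrow>
     (\<forall>t \<in> {0..T}. f t \<in> carrier_vec d) \<and>
     (\<forall>i<d. (\<lambda>t. f t $ i) \<in> borel_measurable (lebesgue_on {0..T})) \<and>
     integrable (lebesgue_on {0..T}) (\<lambda>t. (eucl_norm (f t))\<^sup>2)"

definition L2_norm_on :: "real \<Rightarrow> (real \<Rightarrow> real vec) \<Rightarrow> real" where
  "L2_norm_on T f = sqrt (\<integral>t. (eucl_norm (f t))\<^sup>2 \<partial>lebesgue_on {0..T})"


section \<open>Bilinear control systems\<close>

definition absolutely_continuous_on :: "real \<Rightarrow> real \<Rightarrow> (real \<Rightarrow> real) \<Rightarrow> bool" where
  "absolutely_continuous_on a b f \<longleftrightarrow>
     (\<forall>\<epsilon>>0. \<exists>\<delta>>0. \<forall>D :: (real \<times> real) set.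
        finite D \<longrightarrow>
        (\<forall>(s, t) \<in> D. a \<le> s \<and> s \<le> t \<and> t \<le> b) \<longrightarrow>
        disjoint_family_on (\<lambda>(s, t). {s<..<t}) D \<longrightarrow>
        (\<Sum>(s, t) \<in> D. t - s) < \<delta> \<longrightarrow>
        (\<Sum>(s, t) \<in> D. \<bar>f t - f s\<bar>) < \<epsilon>)"

definition bilinear_rhs ::
  "nat \<Rightarrow> nat \<Rightarrow> real mat \<Rightarrow> real mat \<Rightarrow> (nat \<Rightarrow> real mat) \<Rightarrow> real vec \<Rightarrow> real vec \<Rightarrow> real vec" where
  "bilinear_rhs n m A B N v z =
     A *\<^sub>v z + B *\<^sub>v v + finsum_vec TYPE(real) n (\<lambda>i. (v $ i) \<cdot>\<^sub>v (N i *\<^sub>v z)) {..<m}"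

text \<open>
  As controls are only square integrable, the state equation with zero initial value is understood
  in the sense of Caratheodory: the state is absolutely continuous on \<open>[0,T]\<close> and satisfies the
  differential equation for almost every \<open>t\<close>. The type of vectors carries no topology, hence
  the formulation by components.
\<close>

definition bilinear_state ::
  "nat \<Rightarrow> nat \<Rightarrow> real \<Rightarrow> real mat \<Rightarrow> real mat \<Rightarrow> (nat \<Rightarrow> real mat) \<Rightarrow>
   (real \<Rightarrow> real vec) \<Rightarrow> (real \<Rightarrow> real vec) \<Rightarrow> bool" where
  "bilinear_state n m T A B N u x \<longleftrightarrow>
     (\<forall>t \<in> {0..T}. x t \<in> carrier_vec n) \<and>
     x 0 = 0\<^sub>v n \<and>
     (\<forall>j<n. absolutely_continuous_on 0 T (\<lambda>t. x t $ j)) \<and>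
     (AE t in lebesgue_on {0..T}. \<forall>j<n.
        ((\<lambda>s. x s $ j) has_real_derivative bilinear_rhs n m A B N (u t) (x t) $ j)
          (at t within {0..T}))"

definition bilinear_output ::
  "nat \<Rightarrow> nat \<Rightarrow> real \<Rightarrow> real mat \<Rightarrow> real mat \<Rightarrow> (nat \<Rightarrow> real mat) \<Rightarrow> real mat \<Rightarrow>
   (real \<Rightarrow> real vec) \<Rightarrow> (real \<Rightarrow> real vec) \<Rightarrow> bool" where
  "bilinear_output n m T A B N C u y \<longleftrightarrow>
     (\<exists>x. bilinear_state n m T A B N u x \<and> (\<forall>t \<in> {0..T}. y t = C *\<^sub>v x t))"

end

theory Submission
  imports Defs
begin

text \<open>
  Let \<open>x\<close> be the state of a truncation and \<open>y\<close> the state of a smaller one, padded with zeros, such that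
  only one singular value \<open>s\<close> is truncated in between. The inequality for \<open>Q\<close> bounds the derivative of
  the energy of \<open>x - y\<close> in the weight \<open>\<Sigma>\<close>, the one for \<open>P\<close> that of \<open>x + y\<close> in the weight
  \<open>s\<^sup>2 \<Sigma>\<^sup>-\<^sup>1\<close>; the bilinear terms are absorbed by the shift \<open>k\<^sup>2 / 2\<close>. In the sum of both energies the
  coupling terms cancel, so that the squared output error is at most \<open>4 s\<^sup>2 \<parallel>u\<parallel>\<^sup>2\<close>. The inequalities are
  inherited by leading principal blocks, hence distinct singular values can be removed one after the
  other, and the triangle inequality adds up the errors. The intermediate truncations need a solution,
  which Picard iteration provides.
\<close>


text \<open>The cancellation is what forces the removal of one singular value at a time. The padded
  smaller state obeys the equation of the larger system except in the removed rows, where its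
  derivative is 0 instead of drift plus forcing. This residual enters the derivative of the
  difference with a plus sign and that of the sum with a minus sign, while in those rows difference
  and sum are the same component of the larger state. The two contributions cancel exactly when the
  weights \<open>\<sigma> i\<close> and \<open>s\<^sup>2 / \<sigma> i\<close> agree there, that is,
  when \<open>\<sigma> i = s\<close>. With the residual split off, the difference carries no forcing
  and the sum carries it twice; completing the square for the latter produces the constant 4. Since
  the control is bounded by \<open>k\<close>, all integrands of the energy argument are bounded and
  measurable. Energies are therefore handled through integral representations only, and absolute
  continuity matters just for the two given states.\<close>

section \<open>Absolutely continuous functions\<close>

text \<open>A gauge argument: at tags outside the null set \<open>N\<close> the derivative controls
  the increment of \<open>f\<close>, while intervals tagged in \<open>N\<close> are forced into an
  open set of measure below \<delta>, where absolute continuity bounds the total increment.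
  Integrability of \<open>g\<close> is part of the conclusion; for the state equation it is not
  known beforehand.\<close>

lemma has_integral_absolutely_continuous:
  fixes f g :: "real \<Rightarrow> real"
  assumes "a \<le> b" and ac: "absolutely_continuous_on a b f"
    and der: "AE t in lebesgue_on {a..b}. (f has_real_derivative g t) (at t within {a..b})"
  shows "(g has_integral f b - f a) {a..b}"
proof -
  have "AE t in lebesgue. t \<in> {a..b} \<longrightarrow> (f has_real_derivative g t) (at t within {a..b})"
    using der by (simp add: AE_restrict_space_iff)
  then obtain N where N: "N \<in> null_sets lebesgue"
    and derN: "\<And>t. t \<in> {a..b} \<Longrightarrow> t \<notin> N \<Longrightarrow> (f has_real_derivative g t) (at t within {a..b})"
    by (auto elim!: AE_E3)
  have negl: "negligible N"
    using N by (simp add: negligible_iff_null_sets)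
  \<comment> \<open>Changing \<open>g\<close> to 0 on \<open>N\<close> leaves the integral alone and
    removes the uncontrolled values of \<open>g\<close> from the Riemann sums, so that only
    increments of \<open>f\<close> remain at tags in \<open>N\<close>.\<close>
  define h where "h x = (if x \<in> N then 0 else g x)" for x
  have "(h has_integral f b - f a) {a..b}"
    unfolding has_integral_real
  proof (intro allI impI)
    fix e :: real assume "0 < e"
    \<comment> \<open>The \<open>+ 1\<close> covers \<open>a = b\<close> and makes the estimate of
      the regular part strict.\<close>
    define \<epsilon> where "\<epsilon> = e / (2 * (b - a + 1))"
    have "0 < \<epsilon>" and \<epsilon>: "\<epsilon> * (b - a) < e / 2"
      using \<open>0 < e\<close> \<open>a \<le> b\<close> by (auto simp: \<epsilon>_def field_simps)
    obtain \<delta> where "0 < \<delta>" and \<delta>: "\<And>D :: (real \<times> real) set. finite D \<Longrightarrow>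
        \<forall>(s, t) \<in> D. a \<le> s \<and> s \<le> t \<and> t \<le> b \<Longrightarrow>
        disjoint_family_on (\<lambda>(s, t). {s<..<t}) D \<Longrightarrow>
        (\<Sum>(s, t) \<in> D. t - s) < \<delta> \<Longrightarrow> (\<Sum>(s, t) \<in> D. \<bar>f t - f s\<bar>) < e / 2"
      using ac[unfolded absolutely_continuous_on_def, rule_format, of "e / 2"] \<open>0 < e\<close> by (auto 4 0)
    obtain U where "open U" "N \<subseteq> U" and U: "U - N \<in> lmeasurable" "emeasure lebesgue (U - N) < ennreal \<delta>"
      using sets_lebesgue_outer_open[OF null_setsD2[OF N] \<open>0 < \<delta>\<close>] by blast
    have Usets: "U \<in> sets lebesgue"
      using \<open>open U\<close> by (simp add: borel_open)
    have "emeasure lebesgue U = emeasure lebesgue (U - N)"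
      using emeasure_Diff_null_set[OF N Usets] by simp
    with U have Um: "U \<in> lmeasurable" and "emeasure lebesgue U < ennreal \<delta>"
      using Usets by (auto simp: fmeasurable_def)
    then have mU: "measure lebesgue U < \<delta>"
      using \<open>0 < \<delta>\<close> by (simp add: emeasure_eq_measure2 ennreal_less_iff)
    have "\<exists>d>0. \<forall>y\<in>{a..b}. \<bar>y - x\<bar> < d \<longrightarrow> \<bar>f y - f x - g x * (y - x)\<bar> \<le> \<epsilon> * \<bar>y - x\<bar>"
      if "x \<in> {a..b} - N" for x
    proof -
      have "(f has_derivative (\<lambda>y. g x * y)) (at x within {a..b})"
        using derN[of x] that by (simp add: has_field_derivative_def)
      then show ?thesis
        using \<open>0 < \<epsilon>\<close> unfolding has_derivative_within_alt by simp
    qed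
    then obtain d where d: "\<And>x. x \<in> {a..b} - N \<Longrightarrow> 0 < d x"
      "\<And>x y. x \<in> {a..b} - N \<Longrightarrow> y \<in> {a..b} \<Longrightarrow> \<bar>y - x\<bar> < d x \<Longrightarrow>
         \<bar>f y - f x - g x * (y - x)\<bar> \<le> \<epsilon> * \<bar>y - x\<bar>"
      by metis
    \<comment> \<open>The value \<open>UNIV\<close> outside the interval is a mere default: tags of
      a division of \<open>{a..b}\<close> never lie there.\<close>
    define \<gamma> where "\<gamma> x = (if x \<in> N then U else if x \<in> {a..b} then ball x (d x) else UNIV)" for x
    have gauge: "gauge \<gamma>"
      using \<open>open U\<close> \<open>N \<subseteq> U\<close> d(1) by (auto simp: gauge_def \<gamma>_def)
    have small: "norm ((\<Sum>(x, K)\<in>D. measure lborel K *\<^sub>R h x) - (f b - f a)) < e"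
      if D: "D tagged_division_of {a..b}" and fine: "\<gamma> fine D" for D
    proof -
      note tag = tagged_division_ofD[OF D]
      have K: "\<exists>s t. K = {s..t} \<and> s \<le> x \<and> x \<le> t \<and> a \<le> s \<and> t \<le> b \<and> x \<in> {a..b}"
        if xK: "(x, K) \<in> D" for x K
      proof -
        obtain s t where "K = cbox s t" using tag(4)[OF xK] by metis
        moreover have "x \<in> K" "K \<subseteq> {a..b}" using tag(2,3)[OF xK] by auto
        ultimately show ?thesis by (auto intro!: exI[of _ s] exI[of _ t])
      qed
      define D1 where "D1 = {p \<in> D. fst p \<notin> N}"
      define D2 where "D2 = {p \<in> D. fst p \<in> N}"
      have fin: "finite D" "finite D1" "finite D2"
        using tag(1) by (auto simp: D1_def D2_def)
      have disj: "D = D1 \<union> D2" "D1 \<inter> D2 = {}"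
        by (auto simp: D1_def D2_def)
      define E where "E = (\<lambda>(x, K). measure lborel K * h x - (f (Sup K) - f (Inf K)))"
      have "(\<Sum>(x, K)\<in>D. measure lborel K *\<^sub>R h x) - (f b - f a) = sum E D"
        unfolding E_def additive_tagged_division_1[OF \<open>a \<le> b\<close> D, of f, symmetric]
        by (simp add: sum_subtractf[symmetric] case_prod_unfold)
      also have "\<bar>sum E D\<bar> \<le> (\<Sum>p\<in>D1. \<bar>E p\<bar>) + (\<Sum>p\<in>D2. \<bar>E p\<bar>)"
        using sum_abs[of E D] fin disj by (simp add: sum.union_disjoint)
      also have "(\<Sum>p\<in>D1. \<bar>E p\<bar>) \<le> (\<Sum>(x, K)\<in>D1. \<epsilon> * measure lborel K)"
      proof (rule sum_mono)
        fix p assume p: "p \<in> D1"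
        obtain x K where xK: "p = (x, K)" by force
        then have "x \<notin> N" "(x, K) \<in> D" using p by (auto simp: D1_def)
        obtain s t where st: "K = {s..t}" "s \<le> x" "x \<le> t" "a \<le> s" "t \<le> b" "x \<in> {a..b}"
          using K[OF \<open>(x, K) \<in> D\<close>] by blast
        have "{s..t} \<subseteq> ball x (d x)"
          using fineD[OF fine \<open>(x, K) \<in> D\<close>] \<open>x \<notin> N\<close> st(1,6) by (simp add: \<gamma>_def)
        then have "s \<in> ball x (d x)" "t \<in> ball x (d x)"
          using st(2,3) by (auto simp del: mem_ball)
        then have close: "\<bar>s - x\<bar> < d x" "\<bar>t - x\<bar> < d x"
          by (auto simp: dist_real_def)
        have "\<bar>f t - f x - g x * (t - x)\<bar> \<le> \<epsilon> * \<bar>t - x\<bar>"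
          using d(2)[of x t] close st \<open>x \<notin> N\<close> by simp
        moreover have "\<bar>f s - f x - g x * (s - x)\<bar> \<le> \<epsilon> * \<bar>s - x\<bar>"
          using d(2)[of x s] close st \<open>x \<notin> N\<close> by simp
        \<comment> \<open>The tag lies between the endpoints, so the two one-sided errors add up to
          \<epsilon> times \<open>(t - x) + (x - s) = t - s\<close>.\<close>
        ultimately have "\<bar>(t - s) * g x - (f t - f s)\<bar> \<le> \<epsilon> * (t - s)"
          using st by (simp add: abs_if algebra_simps split: if_splits)
        then show "\<bar>E p\<bar> \<le> (case p of (x, K) \<Rightarrow> \<epsilon> * measure lborel K)"
          using st \<open>x \<notin> N\<close> by (simp add: E_def xK h_def)
      qed
      also have "\<dots> \<le> (\<Sum>(x, K)\<in>D. \<epsilon> * measure lborel K)"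
        using fin \<open>0 < \<epsilon>\<close> by (intro sum_mono2) (auto simp: D1_def)
      also have "\<dots> = \<epsilon> * (b - a)"
        using additive_content_tagged_division[of D a b] D \<open>a \<le> b\<close>
        by (simp add: case_prod_unfold flip: sum_distrib_left)
      also have "\<dots> < e / 2" by (rule \<epsilon>)
      also have "(\<Sum>p\<in>D2. \<bar>E p\<bar>) = (\<Sum>(x, K)\<in>D2. \<bar>f (Sup K) - f (Inf K)\<bar>)"
        by (rule sum.cong) (auto simp: E_def D2_def h_def)
      also have "\<dots> < e / 2"
      proof -
        define D3 where "D3 = {p \<in> D2. measure lborel (snd p) \<noteq> 0}"
        define \<phi> where "\<phi> = (\<lambda>(x :: real, K :: real set). (Inf K, Sup K))"
        have D3: "\<exists>s t. K = {s..t} \<and> s < t \<and> a \<le> s \<and> t \<le> b \<and> K \<subseteq> U"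
          if "(x, K) \<in> D3" for x K
        proof -
          have "(x, K) \<in> D" "x \<in> N" "measure lborel K \<noteq> 0"
            using that by (auto simp: D3_def D2_def)
          moreover have "K \<subseteq> U"
            using fineD[OF fine \<open>(x, K) \<in> D\<close>] \<open>x \<in> N\<close> by (simp add: \<gamma>_def)
          ultimately show ?thesis
            using K[OF \<open>(x, K) \<in> D\<close>] by (metis content_real_eq_0 linorder_not_le)
        qed
        have zero: "(case p of (x, K) \<Rightarrow> \<bar>f (Sup K) - f (Inf K)\<bar>) = 0" if "p \<in> D2 - D3" for p
        proof -
          obtain x K' where p: "p = (x, K')" by force
          then have "(x, K') \<in> D" "measure lborel K' = 0" using that by (auto simp: D3_def D2_def)
          then obtain s t where "K' = {s..t}" "s \<le> x" "x \<le> t" "measure lborel {s..t} = 0"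
            using K by blast
          then show ?thesis using p by (auto simp: content_real_eq_0)
        qed
        have disj3: "interior K \<inter> interior L = {}"
          if "(x, K) \<in> D3" "(y, L) \<in> D3" "(x, K) \<noteq> (y, L)" for x y K L
          using tag(5)[of x K y L] that by (auto simp: D3_def D2_def)
        have inj: "inj_on \<phi> D3"
        proof (rule inj_onI)
          fix p q assume "p \<in> D3" "q \<in> D3" and eq: "\<phi> p = \<phi> q"
          obtain x K y L where pq: "p = (x, K)" "q = (y, L)" by force
          obtain s t where st: "K = {s..t}" "s < t" using D3 \<open>p \<in> D3\<close> pq by blast
          obtain s' t' where st': "L = {s'..t'}" "s' < t'" using D3 \<open>q \<in> D3\<close> pq by blast
          have "K = L" using eq st st' by (simp add: \<phi>_def pq)
          show "p = q"
          proof (rule ccontr)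
            assume "p \<noteq> q"
            then show False
              using disj3[of x K y L] \<open>p \<in> D3\<close> \<open>q \<in> D3\<close> pq st \<open>K = L\<close> by simp
          qed
        qed
        have dj: "disjoint_family_on (\<lambda>(s, t). {s<..<t}) (\<phi> ` D3)"
          unfolding disjoint_family_on_def
        proof (intro ballI impI)
          fix P Q assume "P \<in> \<phi> ` D3" "Q \<in> \<phi> ` D3" "P \<noteq> Q"
          then obtain p q where pq: "p \<in> D3" "q \<in> D3" "P = \<phi> p" "Q = \<phi> q" "p \<noteq> q" by blast
          obtain x K y L where xK: "p = (x, K)" "q = (y, L)" by force
          obtain s t where st: "K = {s..t}" "s < t" using D3 \<open>p \<in> D3\<close> xK by blast
          obtain s' t' where st': "L = {s'..t'}" "s' < t'" using D3 \<open>q \<in> D3\<close> xK by blast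
          show "(case P of (s, t) \<Rightarrow> {s<..<t}) \<inter> (case Q of (s, t) \<Rightarrow> {s<..<t}) = {}"
            using disj3[of x K y L] pq xK st st' by (simp add: \<phi>_def)
        qed
        have fin3: "finite D3" using fin by (simp add: D3_def)
        have "(\<Sum>(s, t)\<in>\<phi> ` D3. t - s) = (\<Sum>p\<in>D3. measure lebesgue (interior (snd p)))"
          unfolding sum.reindex[OF inj] o_def
        proof (rule sum.cong[OF refl])
          fix p assume "p \<in> D3"
          obtain x K' where p: "p = (x, K')" by force
          obtain s t where "K' = {s..t}" "s < t" using D3 \<open>p \<in> D3\<close> p by blast
          then show "(case \<phi> p of (s, t) \<Rightarrow> t - s) = measure lebesgue (interior (snd p))"
            by (simp add: p \<phi>_def)
        qed
        also have "\<dots> = measure lebesgue (\<Union>p\<in>D3. interior (snd p))"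
        proof (rule measure_UNION'[symmetric, OF fin3])
          show "interior (snd p) \<in> lmeasurable" if "p \<in> D3" for p
          proof -
            obtain x K' where p: "p = (x, K')" by force
            obtain s t where "K' = {s..t}" "s < t" using D3 \<open>p \<in> D3\<close> p by blast
            then show ?thesis by (simp add: p)
          qed
          show "pairwise (\<lambda>p q. disjnt (interior (snd p)) (interior (snd q))) D3"
            unfolding pairwise_def disjnt_def
          proof (intro ballI impI)
            fix p q assume "p \<in> D3" "q \<in> D3" "p \<noteq> q"
            then show "interior (snd p) \<inter> interior (snd q) = {}"
              using disj3[of "fst p" "snd p" "fst q" "snd q"] by simp
          qed
        qed
        also have "\<dots> \<le> measure lebesgue U"
        proof (rule measure_mono_fmeasurable[OF _ _ Um])
          show "(\<Union>p\<in>D3. interior (snd p)) \<subseteq> U"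
          proof
            fix w assume "w \<in> (\<Union>p\<in>D3. interior (snd p))"
            then obtain x K' where "(x, K') \<in> D3" "w \<in> K'"
              using interior_subset by force
            then show "w \<in> U" using D3[of x K'] by auto
          qed
          show "(\<Union>p\<in>D3. interior (snd p)) \<in> sets lebesgue"
            by (intro sets_completionI_sets) (simp add: borel_open open_UN)
        qed
        also have "\<dots> < \<delta>" by (rule mU)
        finally have "(\<Sum>(s, t)\<in>\<phi> ` D3. t - s) < \<delta>" .
        moreover have "\<forall>(s, t)\<in>\<phi> ` D3. a \<le> s \<and> s \<le> t \<and> t \<le> b"
        proof
          fix P assume "P \<in> \<phi> ` D3"
          then obtain x K' where p: "P = \<phi> (x, K')" "(x, K') \<in> D3" by force
          obtain s t where "K' = {s..t}" "s < t" "a \<le> s" "t \<le> b" using D3 p by blast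
          then show "case P of (s, t) \<Rightarrow> a \<le> s \<and> s \<le> t \<and> t \<le> b"
            by (simp add: p \<phi>_def)
        qed
        ultimately have "(\<Sum>(s, t)\<in>\<phi> ` D3. \<bar>f t - f s\<bar>) < e / 2"
          using \<delta>[of "\<phi> ` D3"] fin3 dj by blast
        also have "(\<Sum>(s, t)\<in>\<phi> ` D3. \<bar>f t - f s\<bar>) = (\<Sum>(x, K)\<in>D3. \<bar>f (Sup K) - f (Inf K)\<bar>)"
          unfolding sum.reindex[OF inj] o_def by (simp add: \<phi>_def case_prod_unfold)
        also have "\<dots> = (\<Sum>(x, K)\<in>D2. \<bar>f (Sup K) - f (Inf K)\<bar>)"
          by (rule sum.mono_neutral_left) (use fin zero in \<open>auto simp: D3_def\<close>)
        finally show ?thesis .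
      qed
      finally show ?thesis by simp
    qed
    show "\<exists>\<gamma>. gauge \<gamma> \<and> (\<forall>D. D tagged_division_of {a..b} \<and> \<gamma> fine D \<longrightarrow>
        norm ((\<Sum>(x, K)\<in>D. measure lborel K *\<^sub>R h x) - (f b - f a)) < e)"
      by (intro exI[of _ \<gamma>] conjI allI impI gauge small) auto
  qed
  then show ?thesis
    by (rule has_integral_spike[OF negl, rotated]) (simp add: h_def)
qed


section \<open>Primitives of bounded measurable functions\<close>

text \<open>This class is closed under products as well as sums, which plain integrability is not,
  and on it the Lebesgue and the gauge integral agree. It contains the control components, the
  states and all densities of the energies.\<close>

definition bounded_measurable :: "real \<Rightarrow> (real \<Rightarrow> real) \<Rightarrow> bool" where
  "bounded_measurable T f \<longleftrightarrow>
     f \<in> borel_measurable (lebesgue_on {0..T}) \<and> (\<exists>K. \<forall>t\<in>{0..T}. \<bar>f t\<bar> \<le> K)"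

lemma bounded_measurable_bound:
  assumes "bounded_measurable T f"
  obtains K where "0 \<le> K" "\<And>t. t \<in> {0..T} \<Longrightarrow> \<bar>f t\<bar> \<le> K"
proof -
  obtain K where "\<forall>t\<in>{0..T}. \<bar>f t\<bar> \<le> K"
    using assms by (auto simp: bounded_measurable_def)
  then show thesis
    by (intro that[of "max 0 K"]) (auto intro: max.coboundedI2)
qed

lemma bounded_measurable_const: "bounded_measurable T (\<lambda>t. c)"
  by (auto simp: bounded_measurable_def)

lemma bounded_measurable_add:
  assumes "bounded_measurable T f" "bounded_measurable T g"
  shows "bounded_measurable T (\<lambda>t. f t + g t)"
proof -
  obtain K L where "\<And>t. t \<in> {0..T} \<Longrightarrow> \<bar>f t\<bar> \<le> K" "\<And>t. t \<in> {0..T} \<Longrightarrow> \<bar>g t\<bar> \<le> L"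
    using assms bounded_measurable_bound by metis
  then have "\<forall>t\<in>{0..T}. \<bar>f t + g t\<bar> \<le> K + L"
    by (meson abs_triangle_ineq add_mono order_trans)
  then show ?thesis
    using assms by (auto simp: bounded_measurable_def)
qed

lemma bounded_measurable_mult:
  assumes "bounded_measurable T f" "bounded_measurable T g"
  shows "bounded_measurable T (\<lambda>t. f t * g t)"
proof -
  obtain K L where "0 \<le> K" "\<And>t. t \<in> {0..T} \<Longrightarrow> \<bar>f t\<bar> \<le> K" "\<And>t. t \<in> {0..T} \<Longrightarrow> \<bar>g t\<bar> \<le> L"
    using assms bounded_measurable_bound by metis
  then have "\<forall>t\<in>{0..T}. \<bar>f t * g t\<bar> \<le> K * L"
    by (auto simp: abs_mult intro!: mult_mono)
  then show ?thesis
    using assms by (auto simp: bounded_measurable_def)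
qed

lemma bounded_measurable_diff:
  assumes "bounded_measurable T f" "bounded_measurable T g"
  shows "bounded_measurable T (\<lambda>t. f t - g t)"
  using bounded_measurable_add[OF assms(1)
      bounded_measurable_mult[OF bounded_measurable_const[of T "-1"] assms(2)]] by simp

lemma bounded_measurable_power2:
  "bounded_measurable T f \<Longrightarrow> bounded_measurable T (\<lambda>t. (f t)\<^sup>2)"
  using bounded_measurable_mult[of T f f] by (simp add: power2_eq_square)

lemma bounded_measurable_sum:
  assumes "\<And>i. i \<in> I \<Longrightarrow> bounded_measurable T (f i)"
  shows "bounded_measurable T (\<lambda>t. \<Sum>i\<in>I. f i t)"
  using assms
  by (induction I rule: infinite_finite_induct)
    (auto intro: bounded_measurable_add bounded_measurable_const)

lemmas bounded_measurable_intros = bounded_measurable_const bounded_measurable_add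
  bounded_measurable_diff bounded_measurable_mult bounded_measurable_power2 bounded_measurable_sum

lemma bounded_measurable_continuous:
  assumes "continuous_on {0..T} f"
  shows "bounded_measurable T f"
proof -
  have "bounded (f ` {0..T})"
    using assms by (intro compact_imp_bounded compact_continuous_image) auto
  then show ?thesis
    using assms continuous_imp_measurable_on_sets_lebesgue[of "{0..T}" f]
    by (auto simp: bounded_measurable_def bounded_iff)
qed

lemma bounded_measurable_cong:
  assumes "bounded_measurable T f" "\<And>t. t \<in> {0..T} \<Longrightarrow> f t = g t"
  shows "bounded_measurable T g"
proof -
  have "g \<in> borel_measurable (lebesgue_on {0..T}) \<longleftrightarrow> f \<in> borel_measurable (lebesgue_on {0..T})"
    using assms(2) by (intro measurable_cong) simp
  then show ?thesis
    using assms by (auto simp: bounded_measurable_def)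
qed

lemma bounded_measurable_absolutely_integrable:
  assumes "bounded_measurable T f"
  shows "f absolutely_integrable_on {0..T}"
proof -
  obtain K where "\<And>t. t \<in> {0..T} \<Longrightarrow> \<bar>f t\<bar> \<le> K"
    using assms bounded_measurable_bound by metis
  then show ?thesis
    using assms
    by (intro measurable_bounded_by_integrable_imp_absolutely_integrable[where g = "\<lambda>_. K"])
      (auto simp: bounded_measurable_def)
qed

lemma bounded_measurable_integrable:
  assumes "bounded_measurable T f" "0 \<le> a" "b \<le> T"
  shows "f integrable_on {a..b}"
proof -
  have "f integrable_on {0..T}"
    using bounded_measurable_absolutely_integrable[OF assms(1)] set_lebesgue_integral_eq_integral(1)
    by blast
  then show ?thesis
    by (rule integrable_on_subinterval) (use assms in auto)
qed

text \<open>An integrated form of \<open>x' = f\<close> with \<open>x 0 = 0\<close>: the zero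
  initial value is built in, and no pointwise derivative is mentioned. Such an \<open>x\<close> is
  Lipschitz on \<open>{0..T}\<close>; its values elsewhere are arbitrary.\<close>

definition primitive :: "real \<Rightarrow> (real \<Rightarrow> real) \<Rightarrow> (real \<Rightarrow> real) \<Rightarrow> bool" where
  "primitive T x f \<longleftrightarrow> bounded_measurable T f \<and> (\<forall>t\<in>{0..T}. x t = integral {0..t} f)"

lemma primitive_increment:
  assumes "primitive T x f" "0 \<le> s" "s \<le> t" "t \<le> T"
  shows "x t - x s = integral {s..t} f"
proof -
  have "integral {0..s} f + integral {s..t} f = integral {0..t} f"
    using assms bounded_measurable_integrable[of T f 0 t]
    by (intro Henstock_Kurzweil_Integration.integral_combine) (auto simp: primitive_def)
  then show ?thesis
    using assms by (simp add: primitive_def)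
qed

lemma abs_integral_le:
  assumes "bounded_measurable T f" "0 \<le> s" "s \<le> t" "t \<le> T" "\<And>r. r \<in> {s..t} \<Longrightarrow> \<bar>f r\<bar> \<le> K"
  shows "\<bar>integral {s..t} f\<bar> \<le> K * (t - s)"
proof -
  have "norm (integral {s..t} f) \<le> integral {s..t} (\<lambda>_. K)"
    using assms bounded_measurable_integrable[OF assms(1)]
    by (intro integral_norm_bound_integral) auto
  then show ?thesis
    using assms by (simp add: mult.commute)
qed

lemma primitive_continuous:
  assumes "primitive T x f"
  shows "continuous_on {0..T} x"
proof -
  have "continuous_on {0..T} (\<lambda>t. integral {0..t} f)"
    using assms bounded_measurable_integrable[of T f 0 T]
    by (intro indefinite_integral_continuous_1) (auto simp: primitive_def)
  then show ?thesis
    by (rule continuous_on_eq) (use assms in \<open>simp add: primitive_def\<close>)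
qed

lemmas primitive_bounded_measurable = bounded_measurable_continuous[OF primitive_continuous]

lemma primitive_add:
  assumes "primitive T x f" "primitive T y g"
  shows "primitive T (\<lambda>t. x t + y t) (\<lambda>t. f t + g t)"
  using assms bounded_measurable_integrable[of T _ 0]
  by (auto simp: primitive_def bounded_measurable_add
      Henstock_Kurzweil_Integration.integral_add)

lemma primitive_diff:
  assumes "primitive T x f" "primitive T y g"
  shows "primitive T (\<lambda>t. x t - y t) (\<lambda>t. f t - g t)"
  using assms bounded_measurable_integrable[of T _ 0]
  by (auto simp: primitive_def bounded_measurable_diff
      Henstock_Kurzweil_Integration.integral_diff)

lemma primitive_cmult:
  assumes "primitive T x f"
  shows "primitive T (\<lambda>t. c * x t) (\<lambda>t. c * f t)"
  using assms by (auto simp: primitive_def intro!: bounded_measurable_intros)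

lemma primitive_sum:
  assumes "\<And>i. i \<in> I \<Longrightarrow> primitive T (x i) (f i)"
  shows "primitive T (\<lambda>t. \<Sum>i\<in>I. x i t) (\<lambda>t. \<Sum>i\<in>I. f i t)"
  using assms
proof (induction I rule: infinite_finite_induct)
  case (insert i I)
  then show ?case using primitive_add[of T "x i" "f i"] by simp
qed (auto simp: primitive_def bounded_measurable_const)

text \<open>Integration by parts. The factors need not be differentiable everywhere, but the
  difference \<phi> between the product and the candidate primitive is, which avoids any
  almost-everywhere argument. Applied to equal factors it yields the densities of the quadratic
  energies.\<close>

lemma primitive_mult:
  assumes x: "primitive T x f" and y: "primitive T y g"
  shows "primitive T (\<lambda>t. x t * y t) (\<lambda>t. x t * g t + y t * f t)"
proof -
  define h where "h t = x t * g t + y t * f t" for t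
  have bm: "bounded_measurable T f" "bounded_measurable T g"
    using x y by (auto simp: primitive_def)
  have h: "bounded_measurable T h"
    unfolding h_def using bm primitive_bounded_measurable[OF x] primitive_bounded_measurable[OF y]
    by (intro bounded_measurable_intros) auto
  obtain F where F: "0 \<le> F" "\<And>t. t \<in> {0..T} \<Longrightarrow> \<bar>f t\<bar> \<le> F"
    using bm bounded_measurable_bound by metis
  obtain G where G: "0 \<le> G" "\<And>t. t \<in> {0..T} \<Longrightarrow> \<bar>g t\<bar> \<le> G"
    using bm bounded_measurable_bound by metis
  define \<phi> where "\<phi> t = x t * y t - integral {0..t} h" for t
  have H: "primitive T (\<lambda>t. integral {0..t} h) h"
    using h by (simp add: primitive_def)
  text \<open>The error is of second order in the length of the interval, hence \<open>\<phi>\<close> has derivative 0.\<close>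
  have quadratic: "\<bar>\<phi> t - \<phi> s\<bar> \<le> 2 * F * G * (t - s)\<^sup>2" if st: "0 \<le> s" "s \<le> t" "t \<le> T" for s t
  proof -
    have int: "f integrable_on {s..t}" "g integrable_on {s..t}" "h integrable_on {s..t}"
      using bm h st by (auto intro: bounded_measurable_integrable)
    have "\<phi> t - \<phi> s = (x t - x s) * y t + x s * (y t - y s)
        - (integral {0..t} h - integral {0..s} h)"
      by (simp add: \<phi>_def algebra_simps)
    also have "\<dots> = integral {s..t} f * y t + x s * integral {s..t} g - integral {s..t} h"
      using primitive_increment[OF x] primitive_increment[OF y] primitive_increment[OF H] st by simp
    also have "\<dots> = integral {s..t} (\<lambda>r. f r * y t + x s * g r - h r)"
      using int by (intro integral_unique[symmetric] has_integral_diff has_integral_add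
          has_integral_mult_left has_integral_mult_right integrable_integral)
    also have "\<bar>\<dots>\<bar> \<le> (2 * F * G * (t - s)) * (t - s)"
    proof (rule abs_integral_le[of T])
      show "bounded_measurable T (\<lambda>r. f r * y t + x s * g r - h r)"
        using bm h by (intro bounded_measurable_intros)
      fix r assume r: "r \<in> {s..t}"
      have "\<bar>y t - y r\<bar> \<le> G * (t - r)"
        using primitive_increment[OF y, of r t] abs_integral_le[OF bm(2), of r t G] G r st by simp
      also have "\<dots> \<le> G * (t - s)"
        using G r by (intro mult_left_mono) auto
      finally have 1: "\<bar>f r\<bar> * \<bar>y t - y r\<bar> \<le> F * (G * (t - s))"
        using F r st by (intro mult_mono) auto
      have "\<bar>x r - x s\<bar> \<le> F * (r - s)"
        using primitive_increment[OF x, of s r] abs_integral_le[OF bm(1), of s r F] F r st by simp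
      also have "\<dots> \<le> F * (t - s)"
        using F r by (intro mult_left_mono) auto
      finally have 2: "\<bar>x r - x s\<bar> * \<bar>g r\<bar> \<le> (F * (t - s)) * G"
        using F G r st by (intro mult_mono) auto
      \<comment> \<open>With \<open>y\<close> frozen at the right endpoint and \<open>x\<close> at
        the left one, the integrand consists of a bounded density times a Lipschitz increment,
        twice; this gains the second factor \<open>t - s\<close>.\<close>
      have "f r * y t + x s * g r - h r = f r * (y t - y r) - (x r - x s) * g r"
        by (simp add: h_def algebra_simps)
      also have "\<bar>\<dots>\<bar> \<le> \<bar>f r\<bar> * \<bar>y t - y r\<bar> + \<bar>x r - x s\<bar> * \<bar>g r\<bar>"
        by (metis abs_mult abs_triangle_ineq4)
      also have "\<dots> \<le> 2 * F * G * (t - s)"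
        using 1 2 by (simp add: algebra_simps)
      finally show "\<bar>f r * y t + x s * g r - h r\<bar> \<le> 2 * F * G * (t - s)" .
    qed (use st in auto)
    finally show ?thesis
      by (simp add: power2_eq_square mult.assoc)
  qed
  define K where "K = 2 * F * G"
  have "0 \<le> K" using F G by (simp add: K_def)
  have quad: "\<bar>\<phi> t - \<phi> s\<bar> \<le> K * \<bar>t - s\<bar>\<^sup>2" if "s \<in> {0..T}" "t \<in> {0..T}" for s t
    using quadratic[of s t] quadratic[of t s] that
    by (cases "s \<le> t") (auto simp: K_def power2_commute abs_minus_commute)
  have "(\<phi> has_derivative (\<lambda>h. 0)) (at s within {0..T})" if s: "s \<in> {0..T}" for s
    unfolding has_derivative_within_alt
  proof (intro conjI allI impI)
    fix e :: real assume "0 < e"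
    \<comment> \<open>The witness has \<open>K + 1\<close> instead of \<open>K\<close> as
      denominator because \<open>K\<close> may be 0.\<close>
    show "\<exists>d>0. \<forall>t\<in>{0..T}. norm (t - s) < d \<longrightarrow> norm (\<phi> t - \<phi> s - 0) \<le> e * norm (t - s)"
    proof (intro exI[of _ "e / (K + 1)"] conjI ballI impI)
      show "0 < e / (K + 1)" using \<open>0 < e\<close> \<open>0 \<le> K\<close> by simp
      fix t assume "t \<in> {0..T}" and lt: "norm (t - s) < e / (K + 1)"
      then have "(K + 1) * \<bar>t - s\<bar> \<le> e"
        using \<open>0 \<le> K\<close> by (simp add: field_simps)
      then have "K * \<bar>t - s\<bar> \<le> e"
        by (simp add: algebra_simps)
      then have "K * \<bar>t - s\<bar> * \<bar>t - s\<bar> \<le> e * \<bar>t - s\<bar>"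
        by (intro mult_right_mono) auto
      then show "norm (\<phi> t - \<phi> s - 0) \<le> e * norm (t - s)"
        using quad[OF s \<open>t \<in> {0..T}\<close>] by (simp add: power2_eq_square mult.assoc del: abs_mult_self_eq)
    qed
  qed simp
  then obtain c where c: "\<And>t. t \<in> {0..T} \<Longrightarrow> \<phi> t = c"
    using has_derivative_zero_constant[of "{0..T}" \<phi>] by auto
  have "\<phi> t = 0" if "t \<in> {0..T}" for t
  proof -
    have "\<phi> t = \<phi> 0" using c that by simp
    also have "\<dots> = 0" using x that by (simp add: \<phi>_def primitive_def)
    finally show ?thesis .
  qed
  then show ?thesis
    using h by (simp add: primitive_def \<phi>_def h_def[abs_def])
qed


section \<open>Linear equations with bounded measurable coefficients\<close>

text \<open>A finite sum of squares is one bounded measurable function dominating the whole family;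
  \<open>\<bar>x\<bar> \<le> 1 + x\<^sup>2\<close> turns its bound into a bound of the
  members.\<close>

lemma bounded_measurable_uniform_bound:
  assumes "finite I" "\<And>i. i \<in> I \<Longrightarrow> bounded_measurable T (f i)"
  obtains K where "0 \<le> K" "\<And>i t. i \<in> I \<Longrightarrow> t \<in> {0..T} \<Longrightarrow> \<bar>f i t\<bar> \<le> K"
proof -
  have "bounded_measurable T (\<lambda>t. \<Sum>i\<in>I. (f i t)\<^sup>2)"
    using assms by (intro bounded_measurable_intros) auto
  then obtain K where K: "0 \<le> K" "\<And>t. t \<in> {0..T} \<Longrightarrow> \<bar>\<Sum>i\<in>I. (f i t)\<^sup>2\<bar> \<le> K"
    by (rule bounded_measurable_bound) blast
  have "\<bar>f i t\<bar> \<le> 1 + K" if "i \<in> I" "t \<in> {0..T}" for i t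
  proof -
    have "(f i t)\<^sup>2 \<le> (\<Sum>i\<in>I. (f i t)\<^sup>2)"
      using assms(1) that by (intro member_le_sum) auto
    also have "\<dots> \<le> K" using K(2)[OF that(2)] by simp
    finally have "(f i t)\<^sup>2 \<le> K" .
    moreover have "\<bar>f i t\<bar> \<le> 1 + (f i t)\<^sup>2"
      using zero_le_power2[of "\<bar>f i t\<bar> - 1"] zero_le_power2[of "f i t"]
      by (simp add: power2_diff)
    ultimately show ?thesis by simp
  qed
  with K(1) show thesis by (intro that[of "1 + K"]) auto
qed

lemma integral_exp_le:
  fixes c t :: real
  assumes "0 < c" "0 \<le> t"
  shows "integral {0..t} (\<lambda>s. exp (c * s)) \<le> exp (c * t) / c"
proof -
  have "((\<lambda>s. exp (c * s)) has_integral exp (c * t) / c - exp (c * 0) / c) {0..t}"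
    using assms by (intro fundamental_theorem_of_calculus)
      (auto intro!: derivative_eq_intros simp: has_real_derivative_iff_has_vector_derivative[symmetric])
  then show ?thesis
    using assms by (auto dest: integral_unique)
qed

text \<open>Picard iteration; the weight \<open>exp (c * t)\<close> makes the integral operator a contraction on the
  whole interval.\<close>

lemma linear_ode_solution_exists:
  fixes a :: "nat \<Rightarrow> nat \<Rightarrow> real \<Rightarrow> real" and f :: "nat \<Rightarrow> real \<Rightarrow> real"
  assumes a: "\<And>i l. i < d \<Longrightarrow> l < d \<Longrightarrow> bounded_measurable T (a i l)"
    and f: "\<And>i. i < d \<Longrightarrow> bounded_measurable T (f i)"
  shows "\<exists>x. \<forall>i<d. primitive T (x i) (\<lambda>t. (\<Sum>l<d. a i l t * x l t) + f i t)"
proof -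
  define \<Psi> where "\<Psi> x i t = (\<Sum>l<d. a i l t * x l t) + f i t"
    for x :: "nat \<Rightarrow> real \<Rightarrow> real" and i t
  define X where "X q = ((\<lambda>x i t. integral {0..t} (\<Psi> x i)) ^^ q) (\<lambda>i t. 0)" for q
  have X_0: "X 0 i t = 0" and X_Suc: "X (Suc q) i t = integral {0..t} (\<Psi> (X q) i)" for q i t
    by (simp_all add: X_def)
  have bm\<Psi>: "bounded_measurable T (\<Psi> x i)"
    if "i < d" "\<And>l. l < d \<Longrightarrow> bounded_measurable T (x l)" for x i
    unfolding \<Psi>_def[abs_def] using a f that by (intro bounded_measurable_intros) auto
  have "\<forall>i<d. bounded_measurable T (X q i)" for q
  proof (induction q)
    case 0
    have "X 0 i = (\<lambda>t. 0)" for i by (rule ext) (rule X_0)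
    then show ?case by (simp add: bounded_measurable_const)
  next
    case (Suc q)
    then have "primitive T (X (Suc q) i) (\<Psi> (X q) i)" if "i < d" for i
      using bm\<Psi> that by (simp add: primitive_def X_Suc)
    then show ?case using primitive_bounded_measurable by blast
  qed
  then have X_bm: "bounded_measurable T (X q i)" if "i < d" for q i using that by blast
  have X_prim: "primitive T (X (Suc q) i) (\<Psi> (X q) i)" if "i < d" for q i
    using bm\<Psi> X_bm that by (simp add: primitive_def X_Suc)
  obtain L where L0: "0 \<le> L" and "\<And>p t. p \<in> {..<d} \<times> {..<d} \<Longrightarrow> t \<in> {0..T} \<Longrightarrow> \<bar>a (fst p) (snd p) t\<bar> \<le> L"
    by (rule bounded_measurable_uniform_bound[of "{..<d} \<times> {..<d}" T "\<lambda>p. a (fst p) (snd p)"])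
      (auto simp: a)
  then have L: "\<bar>a i l t\<bar> \<le> L" if "i < d" "l < d" "t \<in> {0..T}" for i l t
    using that by force
  obtain F where F: "0 \<le> F" "\<And>i t. i \<in> {..<d} \<Longrightarrow> t \<in> {0..T} \<Longrightarrow> \<bar>f i t\<bar> \<le> F"
    by (rule bounded_measurable_uniform_bound[of "{..<d}" T f]) (auto simp: f)
  obtain C where C: "0 \<le> C" "\<And>i t. i \<in> {..<d} \<Longrightarrow> t \<in> {0..T} \<Longrightarrow> \<bar>X 1 i t\<bar> \<le> C"
    by (rule bounded_measurable_uniform_bound[of "{..<d}" T "X 1"]) (auto simp: X_bm)
  \<comment> \<open>Integrating \<open>exp (c * s)\<close> gains a factor \<open>1 / c\<close>, so
    this choice gives \<open>d * L / c \<le> 1/2\<close>, the contraction rate; the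
    \<open>+ 1\<close> keeps \<open>c\<close> positive if \<open>d * L = 0\<close>.\<close>
  define c where "c = 2 * d * L + 1"
  have "0 < c" using L0 by (simp add: c_def add_nonneg_pos)
  have step: "\<bar>X (Suc q) i t - X q i t\<bar> \<le> C * (1/2) ^ q * exp (c * t)"
    if "i < d" "t \<in> {0..T}" for q i t
    using that
  proof (induction q arbitrary: i t)
    case 0
    have "\<bar>X 1 i t\<bar> \<le> C * 1" using C(2)[of i t] 0 by simp
    also have "\<dots> \<le> C * exp (c * t)"
      using C(1) \<open>0 < c\<close> 0 by (intro mult_left_mono) auto
    finally show ?case by (simp add: X_0)
  next
    case (Suc q)
    let ?D = "\<lambda>t. \<Psi> (X (Suc q)) i t - \<Psi> (X q) i t"
    let ?E = "\<lambda>s. (d * L * C * (1/2) ^ q) * exp (c * s)"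
    have prim: "primitive T (\<lambda>t. X (Suc (Suc q)) i t - X (Suc q) i t) ?D"
      using X_prim Suc.prems by (intro primitive_diff)
    then have "\<bar>X (Suc (Suc q)) i t - X (Suc q) i t\<bar> = \<bar>integral {0..t} ?D\<bar>"
      using Suc.prems by (simp add: primitive_def)
    also have "\<dots> \<le> integral {0..t} ?E"
    proof -
      have "norm (integral {0..t} ?D) \<le> integral {0..t} ?E"
      proof (rule integral_norm_bound_integral)
        show "?D integrable_on {0..t}"
          using prim Suc.prems by (auto simp: primitive_def intro: bounded_measurable_integrable)
        show "?E integrable_on {0..t}"
          by (intro integrable_continuous_interval continuous_intros)
        fix s assume "s \<in> {0..t}"
        then have s: "s \<in> {0..T}" using Suc.prems by auto
        have "?D s = (\<Sum>l<d. a i l s * (X (Suc q) l s - X q l s))"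
          by (simp add: \<Psi>_def sum_subtractf right_diff_distrib)
        also have "\<bar>\<dots>\<bar> \<le> (\<Sum>l<d. \<bar>a i l s * (X (Suc q) l s - X q l s)\<bar>)"
          by (rule sum_abs)
        also have "\<dots> \<le> (\<Sum>l<d. L * (C * (1/2) ^ q * exp (c * s)))"
        proof (rule sum_mono)
          fix l assume "l \<in> {..<d}"
          then show "\<bar>a i l s * (X (Suc q) l s - X q l s)\<bar> \<le> L * (C * (1/2) ^ q * exp (c * s))"
            using Suc.IH[of l s] L0 L Suc.prems s unfolding abs_mult by (intro mult_mono) auto
        qed
        finally show "norm (?D s) \<le> ?E s" by (simp add: mult.assoc)
      qed
      then show ?thesis by simp
    qed
    also have "\<dots> = (d * L * C * (1/2) ^ q) * integral {0..t} (\<lambda>s. exp (c * s))"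
      by simp
    also have "\<dots> \<le> (d * L * C * (1/2) ^ q) * (exp (c * t) / c)"
      using L0 C \<open>0 < c\<close> Suc.prems by (intro mult_left_mono integral_exp_le) auto
    also have "\<dots> = (d * L / c) * (C * (1/2) ^ q * exp (c * t))"
      by simp
    also have "\<dots> \<le> (1/2) * (C * (1/2) ^ q * exp (c * t))"
      using L0 C \<open>0 < c\<close> by (intro mult_right_mono) (auto simp: c_def field_simps)
    finally show ?case by simp
  qed
  define M where "M = C * exp (c * T)"
  have stepM: "\<bar>X (Suc q) i t - X q i t\<bar> \<le> M * (1/2) ^ q" if "i < d" "t \<in> {0..T}" for q i t
  proof -
    have "C * (1/2) ^ q * exp (c * t) \<le> C * (1/2) ^ q * exp (c * T)"
      using C \<open>0 < c\<close> that by (intro mult_left_mono) auto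
    with step[OF that, of q] show ?thesis by (simp add: M_def mult_ac)
  qed
  have X_le: "\<bar>X q i t\<bar> \<le> 2 * M" if "i < d" "t \<in> {0..T}" for q i t
  proof -
    \<comment> \<open>The right-hand side is the partial geometric sum of the step bounds, kept
      exact so that the induction closes.\<close>
    have "\<bar>X q i t\<bar> \<le> M * (2 - 2 * (1/2) ^ q)"
    proof (induction q)
      case (Suc q)
      then show ?case using stepM[OF that, of q] by (simp add: algebra_simps)
    qed (simp add: X_0)
    also have "\<dots> \<le> M * 2"
      using C by (intro mult_left_mono) (auto simp: M_def)
    finally show ?thesis by simp
  qed
  \<comment> \<open>A telescoping series: as \<open>X 0\<close> vanishes, its partial sums are the
    iterates. Pointwise convergence with the uniform bound \<open>2 * M\<close> suffices, because
    dominated convergence passes to the limit in the integral equation.\<close>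
  define x where "x i t = (\<Sum>q. X (Suc q) i t - X q i t)" for i t
  have lim: "(\<lambda>q. X q i t) \<longlonglongrightarrow> x i t" if "i < d" "t \<in> {0..T}" for i t
  proof -
    have "summable (\<lambda>q. X (Suc q) i t - X q i t)"
    proof (rule summable_comparison_test')
      show "summable (\<lambda>q. M * (1/2) ^ q)"
        by (intro summable_mult summable_geometric) simp
      show "norm (X (Suc q) i t - X q i t) \<le> M * (1/2) ^ q" if "q \<ge> 0" for q
        using stepM[OF \<open>i < d\<close> \<open>t \<in> {0..T}\<close>, of q] by simp
    qed
    then have "(\<lambda>q. \<Sum>k<q. X (Suc k) i t - X k i t) \<longlonglongrightarrow> x i t"
      unfolding x_def by (rule summable_LIMSEQ)
    then show ?thesis by (simp add: sum_lessThan_telescope[of "\<lambda>q. X q i t"] X_0)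
  qed
  have x_bm: "bounded_measurable T (x i)" if "i < d" for i
    unfolding bounded_measurable_def
  proof
    show "x i \<in> borel_measurable (lebesgue_on {0..T})"
    proof (rule borel_measurable_LIMSEQ_real)
      show "X q i \<in> borel_measurable (lebesgue_on {0..T})" for q
        using X_bm[OF that] by (simp add: bounded_measurable_def)
      show "(\<lambda>q. X q i t) \<longlonglongrightarrow> x i t" if "t \<in> space (lebesgue_on {0..T})" for t
        using lim[OF \<open>i < d\<close>] that by simp
    qed
    have "\<bar>x i t\<bar> \<le> 2 * M" if "t \<in> {0..T}" for t
      using X_le[OF \<open>i < d\<close> that] by (intro LIMSEQ_le_const2[OF tendsto_rabs[OF lim[OF \<open>i < d\<close> that]]]) auto
    then show "\<exists>K. \<forall>t\<in>{0..T}. \<bar>x i t\<bar> \<le> K" by blast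
  qed
  have "primitive T (x i) (\<Psi> x i)" if "i < d" for i
    unfolding primitive_def
  proof (intro conjI ballI)
    show "bounded_measurable T (\<Psi> x i)" using bm\<Psi> x_bm that by blast
    fix t assume t: "t \<in> {0..T}"
    have "(\<lambda>q. integral {0..t} (\<Psi> (X q) i)) \<longlonglongrightarrow> integral {0..t} (\<Psi> x i)"
    proof (rule dominated_convergence(2)[where h = "\<lambda>_. d * (L * (2 * M)) + F"])
      show "\<Psi> (X q) i integrable_on {0..t}" for q
        using bm\<Psi>[OF that X_bm] t by (intro bounded_measurable_integrable) auto
      fix s assume "s \<in> {0..t}"
      then have s: "s \<in> {0..T}" using t by auto
      show "norm (\<Psi> (X q) i s) \<le> d * (L * (2 * M)) + F" for q
      proof -
        have "\<bar>\<Psi> (X q) i s\<bar> \<le> (\<Sum>l<d. \<bar>a i l s * X q l s\<bar>) + \<bar>f i s\<bar>"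
          unfolding \<Psi>_def by (rule order_trans[OF abs_triangle_ineq]) simp
        also have "\<dots> \<le> (\<Sum>l<d. L * (2 * M)) + F"
        proof (intro add_mono sum_mono)
          fix l assume "l \<in> {..<d}"
          then show "\<bar>a i l s * X q l s\<bar> \<le> L * (2 * M)"
            unfolding abs_mult using L0 L X_le s that by (intro mult_mono) auto
        qed (use F that s in auto)
        finally show ?thesis by simp
      qed
      show "(\<lambda>q. \<Psi> (X q) i s) \<longlonglongrightarrow> \<Psi> x i s"
        unfolding \<Psi>_def using lim s by (intro tendsto_intros) auto
    qed auto
    moreover have "(\<lambda>q. integral {0..t} (\<Psi> (X q) i)) \<longlonglongrightarrow> x i t"
      using LIMSEQ_Suc[OF lim[OF that t]] by (simp add: X_Suc)
    ultimately show "x i t = integral {0..t} (\<Psi> x i)"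
      using LIMSEQ_unique by blast
  qed
  then show ?thesis unfolding \<Psi>_def[abs_def] by blast
qed


section \<open>Error bounds in coordinates\<close>

lemma sum_mult_restrict:
  fixes f z :: "nat \<Rightarrow> real"
  assumes "d \<le> n"
  shows "(\<Sum>l<n. f l * (if l < d then z l else 0)) = (\<Sum>l<d. f l * z l)"
  by (rule sum.mono_neutral_cong_right) (use assms in auto)

lemma integral_mono_bounded_measurable:
  assumes "bounded_measurable T f" "bounded_measurable T g" "\<And>t. t \<in> {0..T} \<Longrightarrow> f t \<le> g t"
  shows "integral {0..T} f \<le> integral {0..T} g"
  using assms by (intro integral_le bounded_measurable_integrable) auto

section \<open>Truncated bilinear systems and their Lyapunov forms\<close>

locale bilinear_system =
  fixes n m p :: nat and T k :: real
    and a :: "nat \<Rightarrow> nat \<Rightarrow> real" and b :: "nat \<Rightarrow> nat \<Rightarrow> real" and c :: "nat \<Rightarrow> nat \<Rightarrow> real"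
    and N :: "nat \<Rightarrow> nat \<Rightarrow> nat \<Rightarrow> real" and u :: "real \<Rightarrow> nat \<Rightarrow> real"
  assumes T_nonneg: "0 \<le> T"
    and u_bounded_measurable: "\<And>q. q < m \<Longrightarrow> bounded_measurable T (\<lambda>t. u t q)"
    and u_le: "\<And>t. t \<in> {0..T} \<Longrightarrow> (\<Sum>q<m. (u t q)\<^sup>2) \<le> k\<^sup>2"
begin

text \<open>All truncations share one set of coefficients and differ only in the summation bound
  \<open>d\<close>, which replaces submatrices. The row index \<open>i\<close> is independent of
  \<open>d\<close>, so rows beyond \<open>d\<close> describe how a truncated state acts on removed
  components.\<close>

definition drift :: "nat \<Rightarrow> (nat \<Rightarrow> real) \<Rightarrow> (nat \<Rightarrow> real) \<Rightarrow> nat \<Rightarrow> real" where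
  "drift d v z i = (\<Sum>l<d. a i l * z l) + (\<Sum>q<m. v q * (\<Sum>l<d. N q i l * z l))"

definition forcing :: "(nat \<Rightarrow> real) \<Rightarrow> nat \<Rightarrow> real" where
  "forcing v i = (\<Sum>q<m. b i q * v q)"

definition readout :: "nat \<Rightarrow> (nat \<Rightarrow> real) \<Rightarrow> nat \<Rightarrow> real" where
  "readout d z j = (\<Sum>i<d. c j i * z i)"

definition truncation :: "nat \<Rightarrow> (real \<Rightarrow> nat \<Rightarrow> real) \<Rightarrow> bool" where
  "truncation d x \<longleftrightarrow>
     (\<forall>i<d. primitive T (\<lambda>t. x t i) (\<lambda>t. drift d (u t) (x t) i + forcing (u t) i))"

text \<open>The quadratic form of \<open>Ak^T W + W Ak + sum N_q^T W N_q\<close> for the leading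
  blocks of size \<open>d\<close>, with \<open>W = diag w\<close> and
  \<open>Ak = A + k^2/2 I\<close>. The shift enters through both \<open>Ak^T W\<close> and
  \<open>W Ak\<close>, whence the coefficient \<open>k\<^sup>2\<close>.\<close>

definition lyapunov_form :: "nat \<Rightarrow> (nat \<Rightarrow> real) \<Rightarrow> (nat \<Rightarrow> real) \<Rightarrow> real" where
  "lyapunov_form d w z = 2 * (\<Sum>i<d. w i * z i * (\<Sum>l<d. a i l * z l))
     + k\<^sup>2 * (\<Sum>i<d. w i * (z i)\<^sup>2) + (\<Sum>q<m. \<Sum>i<d. w i * (\<Sum>l<d. N q i l * z l)\<^sup>2)"

lemma forcing_bounded_measurable: "bounded_measurable T (\<lambda>t. forcing (u t) i)"
  unfolding forcing_def by (intro bounded_measurable_intros u_bounded_measurable) simp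

text \<open>For a fixed control the bilinear equation is linear in the state, with coefficients
  \<open>a + sum u_q N_q\<close> that are bounded and measurable because the control is.\<close>

lemma truncation_exists: "\<exists>x. truncation d x"
proof -
  have "\<exists>x. \<forall>i<d. primitive T (x i)
      (\<lambda>t. (\<Sum>l<d. (a i l + (\<Sum>q<m. u t q * N q i l)) * x l t) + forcing (u t) i)"
    by (intro linear_ode_solution_exists forcing_bounded_measurable bounded_measurable_intros
        u_bounded_measurable) simp
  then obtain x where x: "\<forall>i<d. primitive T (x i)
      (\<lambda>t. (\<Sum>l<d. (a i l + (\<Sum>q<m. u t q * N q i l)) * x l t) + forcing (u t) i)" by blast
  have "(\<Sum>l<d. (a i l + (\<Sum>q<m. u t q * N q i l)) * x l t) = drift d (u t) (\<lambda>i. x i t) i" for t i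
  proof -
    have "(\<Sum>q<m. u t q * (\<Sum>l<d. N q i l * x l t)) = (\<Sum>l<d. (\<Sum>q<m. u t q * N q i l) * x l t)"
      by (simp add: sum_distrib_left sum_distrib_right mult.assoc) (rule sum.swap)
    then show ?thesis by (simp add: drift_def distrib_right sum.distrib)
  qed
  with x have "truncation d (\<lambda>t i. x i t)"
    by (simp add: truncation_def)
  then show ?thesis by blast
qed

lemma readout_bounded_measurable:
  assumes "truncation d x"
  shows "bounded_measurable T (\<lambda>t. readout d (x t) j)"
  unfolding readout_def using assms
  by (intro bounded_measurable_intros) (auto simp: truncation_def intro: primitive_bounded_measurable)

lemma drift_restrict:
  assumes "e \<le> d"
  shows "drift d v (\<lambda>i. if i < e then z i else 0) i = drift e v z i"
  using assms by (simp add: drift_def sum_mult_restrict)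

lemma readout_restrict:
  assumes "e \<le> d"
  shows "readout d (\<lambda>i. if i < e then z i else 0) j = readout e z j"
  using assms by (simp add: readout_def sum_mult_restrict)

lemma drift_add: "drift d v (\<lambda>i. x i + y i) i = drift d v x i + drift d v y i"
  by (simp add: drift_def distrib_left sum.distrib)

lemma drift_diff: "drift d v (\<lambda>i. x i - y i) i = drift d v x i - drift d v y i"
  by (simp add: drift_def right_diff_distrib sum_subtractf)

lemma readout_diff: "readout d (\<lambda>i. x i - y i) j = readout d x j - readout d y j"
  by (simp add: readout_def right_diff_distrib sum_subtractf)

text \<open>The drift and shift terms carry a factor \<open>z i\<close> and vanish in the padded
  rows. The images under \<open>N q\<close> need not vanish there, but their weighted squares are
  nonnegative, so dropping them only decreases the form.\<close>

lemma lyapunov_form_restrict: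
  assumes "d \<le> n" "\<And>i. i < n \<Longrightarrow> 0 \<le> w i"
  shows "lyapunov_form d w z \<le> lyapunov_form n w (\<lambda>i. if i < d then z i else 0)"
proof -
  let ?z = "\<lambda>i. if i < d then z i else 0"
  have 1: "(\<Sum>i<n. w i * ?z i * (\<Sum>l<n. a i l * ?z l)) = (\<Sum>i<d. w i * z i * (\<Sum>l<d. a i l * z l))"
    unfolding sum_mult_restrict[OF assms(1)]
    by (rule sum.mono_neutral_cong_right) (use assms in auto)
  have 2: "(\<Sum>i<n. w i * (?z i)\<^sup>2) = (\<Sum>i<d. w i * (z i)\<^sup>2)"
    by (rule sum.mono_neutral_cong_right) (use assms in auto)
  have 3: "(\<Sum>i<d. w i * (\<Sum>l<d. N q i l * z l)\<^sup>2) \<le> (\<Sum>i<n. w i * (\<Sum>l<n. N q i l * ?z l)\<^sup>2)" for q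
    unfolding sum_mult_restrict[OF assms(1)] using assms by (intro sum_mono2) auto
  show ?thesis
    unfolding lyapunov_form_def 1 2 using 3 by (intro add_left_mono sum_mono)
qed

text \<open>The shift of the drift by \<open>k\<^sup>2 / 2\<close> absorbs the bilinear term, since
  \<open>2 z v n \<le> v\<^sup>2 z\<^sup>2 + n\<^sup>2\<close> and the squares of the control values add up to at most \<open>k\<^sup>2\<close>.\<close>

lemma drift_dissipation:
  assumes w: "\<And>i. i < d \<Longrightarrow> 0 \<le> w i" and v: "(\<Sum>q<m. (v q)\<^sup>2) \<le> k\<^sup>2"
  shows "2 * (\<Sum>i<d. w i * z i * drift d v z i) \<le> lyapunov_form d w z"
proof -
  define g where "g q i = (\<Sum>l<d. N q i l * z l)" for q i
  have "2 * (\<Sum>i<d. w i * z i * (\<Sum>q<m. v q * g q i)) = (\<Sum>i<d. \<Sum>q<m. w i * (2 * z i * v q * g q i))"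
    by (simp add: sum_distrib_left mult_ac)
  also have "\<dots> \<le> (\<Sum>i<d. \<Sum>q<m. w i * ((v q)\<^sup>2 * (z i)\<^sup>2 + (g q i)\<^sup>2))"
  proof (intro sum_mono mult_left_mono)
    fix i q
    show "2 * z i * v q * g q i \<le> (v q)\<^sup>2 * (z i)\<^sup>2 + (g q i)\<^sup>2"
      using sum_squares_bound[of "v q * z i" "g q i"] by (simp add: power_mult_distrib mult_ac)
  qed (use w in auto)
  also have "\<dots> = (\<Sum>q<m. (v q)\<^sup>2) * (\<Sum>i<d. w i * (z i)\<^sup>2) + (\<Sum>q<m. \<Sum>i<d. w i * (g q i)\<^sup>2)"
    unfolding sum_product sum.swap[of _ "{..<m}" "{..<d}"]
    by (simp add: sum.distrib distrib_left mult_ac)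
  also have "\<dots> \<le> k\<^sup>2 * (\<Sum>i<d. w i * (z i)\<^sup>2) + (\<Sum>q<m. \<Sum>i<d. w i * (g q i)\<^sup>2)"
    using v w by (intro add_right_mono mult_right_mono sum_nonneg) auto
  finally show ?thesis
    by (simp add: lyapunov_form_def drift_def g_def distrib_left sum.distrib)
qed

end

section \<open>Energy estimates and truncation errors for balanced systems\<close>

locale balanced_bilinear_system = bilinear_system +
  fixes \<sigma> :: "nat \<Rightarrow> real"
  assumes \<sigma>_pos: "\<And>i. i < n \<Longrightarrow> 0 < \<sigma> i"
    and lyapunov_P: "\<And>z. lyapunov_form n (\<lambda>i. 1 / \<sigma> i) z \<le> - (\<Sum>q<m. (\<Sum>i<n. b i q * z i / \<sigma> i)\<^sup>2)"
    and lyapunov_Q: "\<And>z. lyapunov_form n \<sigma> z \<le> - (\<Sum>j<p. (readout n z j)\<^sup>2)"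
begin

lemma lyapunov_Q_restrict:
  assumes "d \<le> n"
  shows "lyapunov_form d \<sigma> z \<le> - (\<Sum>j<p. (readout d z j)\<^sup>2)"
  using order_trans[OF lyapunov_form_restrict[OF assms] lyapunov_Q] \<sigma>_pos assms
  by (simp add: readout_restrict less_imp_le)

text \<open>Inheritance works for an inequality written with the inverse Gramian because that
  Gramian is diagonal: the leading block of its inverse is the inverse of its leading block.\<close>

lemma lyapunov_P_restrict:
  assumes "d \<le> n"
  shows "lyapunov_form d (\<lambda>i. 1 / \<sigma> i) z \<le> - (\<Sum>q<m. (\<Sum>i<d. b i q * z i / \<sigma> i)\<^sup>2)"
proof -
  have "(\<Sum>i<n. b i q * (if i < d then z i else 0) / \<sigma> i) = (\<Sum>i<d. b i q * z i / \<sigma> i)" for q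
    by (rule sum.mono_neutral_cong_right) (use assms in auto)
  moreover have "lyapunov_form d (\<lambda>i. 1 / \<sigma> i) z
      \<le> lyapunov_form n (\<lambda>i. 1 / \<sigma> i) (\<lambda>i. if i < d then z i else 0)"
    using \<sigma>_pos by (intro lyapunov_form_restrict[OF assms]) (simp add: less_imp_le)
  ultimately show ?thesis
    using lyapunov_P[of "\<lambda>i. if i < d then z i else 0"] by simp
qed

text \<open>With \<open>g\<close> standing for \<open>B^T \<Sigma>^-1 z\<close>, the P inequality
  leaves \<open>- |g|^2\<close>, and the doubled forcing contributes
  \<open>4 <u, g> \<le> 4 |u|^2 + |g|^2\<close>, so the squares of \<open>g\<close> cancel.\<close>

lemma controllability_dissipation:
  assumes "d \<le> n" "t \<in> {0..T}"
  shows "2 * (\<Sum>i<d. 1 / \<sigma> i * z i * (drift d (u t) z i + 2 * forcing (u t) i)) \<le> 4 * (\<Sum>q<m. (u t q)\<^sup>2)"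
proof -
  define g where "g q = (\<Sum>i<d. b i q * z i / \<sigma> i)" for q
  have "(\<Sum>i<d. 1 / \<sigma> i * z i * forcing (u t) i) = (\<Sum>q<m. u t q * g q)"
    unfolding g_def forcing_def sum_distrib_left
    by (subst sum.swap) (simp add: mult_ac)
  moreover have "2 * (\<Sum>i<d. 1 / \<sigma> i * z i * drift d (u t) z i) \<le> - (\<Sum>q<m. (g q)\<^sup>2)"
    using drift_dissipation[OF _ u_le[OF assms(2)], of d "\<lambda>i. 1 / \<sigma> i" z]
      lyapunov_P_restrict[OF assms(1), of z] \<sigma>_pos assms(1)
    by (force simp: g_def less_imp_le)
  moreover have "(\<Sum>q<m. 4 * (u t q * g q)) \<le> (\<Sum>q<m. 4 * (u t q)\<^sup>2 + (g q)\<^sup>2)"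
  proof (rule sum_mono)
    fix q
    show "4 * (u t q * g q) \<le> 4 * (u t q)\<^sup>2 + (g q)\<^sup>2"
      using sum_squares_bound[of "2 * u t q" "g q"] by (simp add: power_mult_distrib)
  qed
  moreover have "(\<Sum>i<d. 1 / \<sigma> i * z i * (drift d (u t) z i + 2 * forcing (u t) i))
      = (\<Sum>i<d. 1 / \<sigma> i * z i * drift d (u t) z i) + 2 * (\<Sum>i<d. 1 / \<sigma> i * z i * forcing (u t) i)"
    by (simp add: distrib_left sum.distrib sum_distrib_left mult_ac)
  ultimately show ?thesis
    by (simp add: sum.distrib flip: sum_distrib_left)
qed

text \<open>A dissipation inequality in integrated form: the storage function \<open>V\<close> is 0
  at time 0 and nonnegative at \<open>T\<close>, so the integral of \<open>V'\<close> is
  nonnegative, while \<open>V'\<close> is at most the supplied \<open>4 s^2 |u|^2\<close> minus the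
  squared output error.\<close>

lemma one_step_error:
  assumes ed: "e \<le> d" "d \<le> n" and s: "0 < s" "\<And>i. e \<le> i \<Longrightarrow> i < d \<Longrightarrow> \<sigma> i = s"
    and x: "truncation d x" and y: "truncation e y"
  shows "integral {0..T} (\<lambda>t. \<Sum>j<p. (readout d (x t) j - readout e (y t) j)\<^sup>2)
    \<le> 4 * s\<^sup>2 * integral {0..T} (\<lambda>t. \<Sum>q<m. (u t q)\<^sup>2)"
proof -
  define ye where "ye t i = (if i < e then y t i else 0)" for t i
  \<comment> \<open>The true density of the padded state. In the rows from \<open>e\<close> on it is
    0, although the drift of \<open>ye\<close> there need not be.\<close>
  define fe where "fe t i = (if i < e then drift d (u t) (ye t) i + forcing (u t) i else 0)" for t i
  define z where "z t i = x t i - ye t i" for t i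
  define w where "w t i = x t i + ye t i" for t i
  define z' where "z' t i = drift d (u t) (x t) i + forcing (u t) i - fe t i" for t i
  define w' where "w' t i = drift d (u t) (x t) i + forcing (u t) i + fe t i" for t i
  have drift_ye: "drift d (u t) (ye t) i = drift e (u t) (y t) i" for t i
    unfolding ye_def by (rule drift_restrict[OF ed(1)])
  have prim_x: "primitive T (\<lambda>t. x t i) (\<lambda>t. drift d (u t) (x t) i + forcing (u t) i)" if "i < d" for i
    using x that by (simp add: truncation_def)
  have prim_ye: "primitive T (\<lambda>t. ye t i) (\<lambda>t. fe t i)" for i
  proof (cases "i < e")
    case True
    then show ?thesis
      using y by (simp add: truncation_def ye_def[of _ i] fe_def drift_ye)
  next
    case False
    then show ?thesis
      by (simp add: ye_def[of _ i] fe_def primitive_def bounded_measurable_const)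
  qed
  have prim_z: "primitive T (\<lambda>t. z t i) (\<lambda>t. z' t i)" if "i < d" for i
    unfolding z_def z'_def by (rule primitive_diff[OF prim_x[OF that] prim_ye])
  have prim_w: "primitive T (\<lambda>t. w t i) (\<lambda>t. w' t i)" if "i < d" for i
    unfolding w_def w'_def by (rule primitive_add[OF prim_x[OF that] prim_ye])
  \<comment> \<open>Squares are written as products so that \<open>V'\<close> has the shape
    delivered by \<open>primitive_mult\<close>.\<close>
  define V where "V t = (\<Sum>i<d. \<sigma> i * (z t i * z t i)) + s\<^sup>2 * (\<Sum>i<d. 1 / \<sigma> i * (w t i * w t i))" for t
  define V' where "V' t = (\<Sum>i<d. \<sigma> i * (z t i * z' t i + z t i * z' t i))
    + s\<^sup>2 * (\<Sum>i<d. 1 / \<sigma> i * (w t i * w' t i + w t i * w' t i))" for t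
  have V: "primitive T V V'"
    unfolding V_def[abs_def] V'_def[abs_def] using prim_z prim_w
    by (intro primitive_add primitive_cmult primitive_sum primitive_mult) auto
  have \<sigma>_nonneg: "0 \<le> \<sigma> i" if "i < d" for i
    using \<sigma>_pos[of i] ed that by simp
  have "0 \<le> (\<Sum>i<d. \<sigma> i * (z T i * z T i))" "0 \<le> (\<Sum>i<d. 1 / \<sigma> i * (w T i * w T i))"
    by (intro sum_nonneg; simp add: \<sigma>_nonneg)+
  then have "0 \<le> V T"
    by (simp add: V_def)
  also have "V T = integral {0..T} V'"
    using V T_nonneg by (simp add: primitive_def)
  also have "\<dots> \<le> integral {0..T} (\<lambda>t. 4 * s\<^sup>2 * (\<Sum>q<m. (u t q)\<^sup>2)
      - (\<Sum>j<p. (readout d (x t) j - readout e (y t) j)\<^sup>2))"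
  proof (rule integral_mono_bounded_measurable)
    show "bounded_measurable T V'" using V by (simp add: primitive_def)
    show "bounded_measurable T (\<lambda>t. 4 * s\<^sup>2 * (\<Sum>q<m. (u t q)\<^sup>2)
      - (\<Sum>j<p. (readout d (x t) j - readout e (y t) j)\<^sup>2))"
      by (intro bounded_measurable_intros readout_bounded_measurable x y u_bounded_measurable) simp
    fix t assume t: "t \<in> {0..T}"
    \<comment> \<open>In a kept row the forcing cancels in \<open>z'\<close> and doubles in
      \<open>w'\<close>. In a removed row \<open>z\<close>, \<open>w\<close> and \<open>x\<close>
      coincide, as do \<open>z'\<close> and \<open>w'\<close>; the two drifts on the right then add
      up to twice that of \<open>x\<close>, since both weights are \<open>s\<close>.\<close>
    have "\<sigma> i * (z t i * z' t i) + s\<^sup>2 * (1 / \<sigma> i * (w t i * w' t i)) =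
      \<sigma> i * z t i * drift d (u t) (z t) i
      + s\<^sup>2 * (1 / \<sigma> i * w t i * (drift d (u t) (w t) i + 2 * forcing (u t) i))" if "i < d" for i
    proof -
      have fz: "drift d (u t) (z t) i = drift d (u t) (x t) i - drift d (u t) (ye t) i"
        unfolding z_def[abs_def] by (rule drift_diff)
      have fw: "drift d (u t) (w t) i = drift d (u t) (x t) i + drift d (u t) (ye t) i"
        unfolding w_def[abs_def] by (rule drift_add)
      show ?thesis
      proof (cases "i < e")
        case True
        then show ?thesis by (simp add: fz fw z'_def w'_def fe_def)
      next
        case False
        then have "\<sigma> i = s" "ye t i = 0" using s(2)[of i] that by (auto simp: ye_def)
        then show ?thesis using False s(1)
          by (simp add: fz fw z'_def w'_def fe_def z_def w_def power2_eq_square) (simp add: algebra_simps)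
      qed
    qed
    then have eq: "(\<Sum>i<d. \<sigma> i * (z t i * z' t i) + s\<^sup>2 * (1 / \<sigma> i * (w t i * w' t i))) =
      (\<Sum>i<d. \<sigma> i * z t i * drift d (u t) (z t) i
      + s\<^sup>2 * (1 / \<sigma> i * w t i * (drift d (u t) (w t) i + 2 * forcing (u t) i)))"
      by (intro sum.cong refl) simp
    have split: "(\<Sum>i<d. f i + r * g i) = (\<Sum>i<d. f i) + r * (\<Sum>i<d. g i)" for f g and r :: real
      by (simp add: sum.distrib sum_distrib_left)
    have regroup: "2 * (p + r * q) = 2 * p + r * (2 * q)" for p q r :: real
      by (simp add: distrib_left)
    have "V' t = 2 * (\<Sum>i<d. \<sigma> i * (z t i * z' t i) + s\<^sup>2 * (1 / \<sigma> i * (w t i * w' t i)))"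
      unfolding V'_def mult_2[symmetric] mult.left_commute[of _ 2] sum_distrib_left[symmetric] sum.distrib
      by (simp only: distrib_left mult.left_commute)
    also have "\<dots> = 2 * (\<Sum>i<d. \<sigma> i * z t i * drift d (u t) (z t) i)
      + s\<^sup>2 * (2 * (\<Sum>i<d. 1 / \<sigma> i * w t i * (drift d (u t) (w t) i + 2 * forcing (u t) i)))"
      unfolding eq split by (rule regroup)
    also have "2 * (\<Sum>i<d. \<sigma> i * z t i * drift d (u t) (z t) i) \<le> - (\<Sum>j<p. (readout d (z t) j)\<^sup>2)"
      using \<sigma>_pos ed
      by (intro order_trans[OF drift_dissipation[OF _ u_le[OF t]] lyapunov_Q_restrict]) (auto simp: less_imp_le)
    also have "s\<^sup>2 * (2 * (\<Sum>i<d. 1 / \<sigma> i * w t i * (drift d (u t) (w t) i + 2 * forcing (u t) i)))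
        \<le> s\<^sup>2 * (4 * (\<Sum>q<m. (u t q)\<^sup>2))"
      by (intro mult_left_mono controllability_dissipation[OF ed(2) t]) simp
    finally show "V' t \<le> 4 * s\<^sup>2 * (\<Sum>q<m. (u t q)\<^sup>2)
        - (\<Sum>j<p. (readout d (x t) j - readout e (y t) j)\<^sup>2)"
      unfolding z_def[abs_def] readout_diff ye_def[abs_def] readout_restrict[OF ed(1)]
      by (simp add: mult_ac)
  qed
  also have "\<dots> = 4 * s\<^sup>2 * integral {0..T} (\<lambda>t. \<Sum>q<m. (u t q)\<^sup>2)
      - integral {0..T} (\<lambda>t. \<Sum>j<p. (readout d (x t) j - readout e (y t) j)\<^sup>2)"
  proof -
    have "bounded_measurable T (\<lambda>t. \<Sum>q<m. (u t q)\<^sup>2)"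
      by (intro bounded_measurable_intros u_bounded_measurable) simp
    moreover have "bounded_measurable T (\<lambda>t. \<Sum>j<p. (readout d (x t) j - readout e (y t) j)\<^sup>2)"
      by (intro bounded_measurable_intros readout_bounded_measurable x y)
    ultimately show ?thesis
      by (intro integral_unique has_integral_diff has_integral_mult_right integrable_integral
          bounded_measurable_integrable) auto
  qed
  finally show ?thesis by simp
qed

text \<open>In the pointwise estimate \<open>(r + q)\<^sup>2 \<le> (1 + \<beta> / \<alpha>) r\<^sup>2 + (1 + \<alpha> / \<beta>) q\<^sup>2\<close> the weights are those that
  are optimal for the two given bounds.\<close>

lemma readout_error_triangle:
  assumes trunc: "truncation d x" "truncation e y" "truncation f z" and pos: "0 < \<alpha>" "0 < \<beta>"
    and xy: "integral {0..T} (\<lambda>t. \<Sum>j<p. (readout d (x t) j - readout e (y t) j)\<^sup>2) \<le> \<alpha>\<^sup>2 * U"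
    and yz: "integral {0..T} (\<lambda>t. \<Sum>j<p. (readout e (y t) j - readout f (z t) j)\<^sup>2) \<le> \<beta>\<^sup>2 * U"
  shows "integral {0..T} (\<lambda>t. \<Sum>j<p. (readout d (x t) j - readout f (z t) j)\<^sup>2) \<le> (\<alpha> + \<beta>)\<^sup>2 * U"
proof -
  define g where "g t = (\<Sum>j<p. (readout d (x t) j - readout e (y t) j)\<^sup>2)" for t
  define h where "h t = (\<Sum>j<p. (readout e (y t) j - readout f (z t) j)\<^sup>2)" for t
  have bm: "bounded_measurable T g" "bounded_measurable T h"
    unfolding g_def[abs_def] h_def[abs_def]
    by (intro bounded_measurable_intros readout_bounded_measurable trunc)+
  have young: "(r + q)\<^sup>2 \<le> (1 + \<beta> / \<alpha>) * r\<^sup>2 + (1 + \<alpha> / \<beta>) * q\<^sup>2" for r q :: real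
  proof -
    have "0 \<le> (\<beta> * r - \<alpha> * q)\<^sup>2 / (\<alpha> * \<beta>)"
      using pos by simp
    also have "\<dots> = (1 + \<beta> / \<alpha>) * r\<^sup>2 + (1 + \<alpha> / \<beta>) * q\<^sup>2 - (r + q)\<^sup>2"
      using pos by (simp add: field_simps power2_eq_square)
    finally show ?thesis by simp
  qed
  have "integral {0..T} (\<lambda>t. \<Sum>j<p. (readout d (x t) j - readout f (z t) j)\<^sup>2)
      \<le> integral {0..T} (\<lambda>t. (1 + \<beta> / \<alpha>) * g t + (1 + \<alpha> / \<beta>) * h t)"
  proof (rule integral_mono_bounded_measurable)
    fix t
    show "(\<Sum>j<p. (readout d (x t) j - readout f (z t) j)\<^sup>2) \<le> (1 + \<beta> / \<alpha>) * g t + (1 + \<alpha> / \<beta>) * h t"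
      unfolding g_def h_def sum_distrib_left sum.distrib[symmetric]
    proof (rule sum_mono)
      fix j
      show "(readout d (x t) j - readout f (z t) j)\<^sup>2 \<le> (1 + \<beta> / \<alpha>) * (readout d (x t) j - readout e (y t) j)\<^sup>2
        + (1 + \<alpha> / \<beta>) * (readout e (y t) j - readout f (z t) j)\<^sup>2"
        using young[of "readout d (x t) j - readout e (y t) j" "readout e (y t) j - readout f (z t) j"]
        by simp
    qed
  qed (intro bounded_measurable_intros readout_bounded_measurable trunc bm)+
  also have "\<dots> = (1 + \<beta> / \<alpha>) * integral {0..T} g + (1 + \<alpha> / \<beta>) * integral {0..T} h"
    using bm by (intro integral_unique has_integral_add has_integral_mult_right integrable_integral
        bounded_measurable_integrable) auto
  also have "\<dots> \<le> (1 + \<beta> / \<alpha>) * (\<alpha>\<^sup>2 * U) + (1 + \<alpha> / \<beta>) * (\<beta>\<^sup>2 * U)"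
    using xy yz pos by (intro add_mono mult_left_mono) (auto simp: g_def[abs_def] h_def[abs_def])
  \<comment> \<open>The optimal weights give \<open>\<alpha> * (\<alpha> + \<beta>)\<close> and
    \<open>\<beta> * (\<alpha> + \<beta>)\<close> as coefficients of \<open>U\<close>.\<close>
  also have "\<dots> = (\<alpha> + \<beta>)\<^sup>2 * U"
    using pos by (simp add: field_simps power2_eq_square)
  finally show ?thesis .
qed

text \<open>Induction on the larger dimension, removing the last distinct value with all its copies.
  The induction is strong because the multiplicity is arbitrary, and \<open>x\<close> is generalised
  because the smaller model becomes the next starting point. Summing over the image of \<sigma>
  counts each value once.\<close>

lemma truncation_error:
  assumes decr: "\<And>i j. i \<le> j \<Longrightarrow> j < n \<Longrightarrow> \<sigma> j \<le> \<sigma> i"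
    and "r < d" "d \<le> n" "truncation d x" "truncation r y"
  shows "integral {0..T} (\<lambda>t. \<Sum>j<p. (readout d (x t) j - readout r (y t) j)\<^sup>2)
    \<le> (2 * \<Sum>(\<sigma> ` {r..<d}))\<^sup>2 * integral {0..T} (\<lambda>t. \<Sum>q<m. (u t q)\<^sup>2)"
  using assms(2-4)
proof (induction d arbitrary: x rule: less_induct)
  case (less d)
  define s where "s = \<sigma> (d - 1)"
  have "0 < s" using \<sigma>_pos less.prems by (simp add: s_def)
  \<comment> \<open>The first index from \<open>r\<close> on with the last value. By monotonicity
    all values from \<open>e\<close> to \<open>d - 1\<close> are squeezed to \<open>s\<close>, so
    they form the tail that one step may remove.\<close>
  define e where "e = (LEAST i. r \<le> i \<and> \<sigma> i = s)"
  have d1: "r \<le> d - 1 \<and> \<sigma> (d - 1) = s" using less.prems by (simp add: s_def)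
  have e: "r \<le> e" "\<sigma> e = s" using LeastI[of "\<lambda>i. r \<le> i \<and> \<sigma> i = s", OF d1] by (auto simp: e_def)
  have "e \<le> d - 1" unfolding e_def by (rule Least_le) (rule d1)
  then have "e < d" using less.prems by simp
  have below: "\<sigma> i \<noteq> s" if "r \<le> i" "i < e" for i
    using not_less_Least[of i "\<lambda>i. r \<le> i \<and> \<sigma> i = s"] that by (auto simp: e_def)
  have const: "\<sigma> i = s" if "e \<le> i" "i < d" for i
  proof (rule antisym)
    show "\<sigma> i \<le> s" using decr[of e i] that less.prems e by simp
    show "s \<le> \<sigma> i" using decr[of i "d - 1"] that less.prems by (simp add: s_def)
  qed
  have split: "\<sigma> ` {r..<d} = insert s (\<sigma> ` {r..<e})"
  proof -
    have "{r..<d} = {r..<e} \<union> {e..<d}" using e \<open>e < d\<close> by auto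
    moreover have "\<sigma> ` {e..<d} = (\<lambda>_. s) ` {e..<d}"
      by (intro image_cong) (auto simp: const)
    then have "\<sigma> ` {e..<d} = {s}" using \<open>e < d\<close> by (simp add: image_constant_conv)
    ultimately show ?thesis by (simp add: image_Un)
  qed
  have "s \<notin> \<sigma> ` {r..<e}" using below by force
  with split have sum: "\<Sum>(\<sigma> ` {r..<d}) = s + \<Sum>(\<sigma> ` {r..<e})" by simp
  show ?case
  proof (cases "e = r")
    case True
    then have "\<Sum>(\<sigma> ` {r..<d}) = s" using sum by simp
    then show ?thesis
      using one_step_error[of r d s x y] less.prems assms(5) const \<open>0 < s\<close> True
      by (simp add: power_mult_distrib)
  next
    case False
    obtain w where w: "truncation e w" using truncation_exists by blast
    \<comment> \<open>The weights in \<open>readout_error_triangle\<close> must be positive, which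
      fails for an empty remainder; hence the separate case \<open>e = r\<close>.\<close>
    have "0 < \<Sum>(\<sigma> ` {r..<e})"
      using \<sigma>_pos False e \<open>e < d\<close> less.prems by (intro sum_pos) auto
    let ?U = "integral {0..T} (\<lambda>t. \<Sum>q<m. (u t q)\<^sup>2)"
    have "integral {0..T} (\<lambda>t. \<Sum>j<p. (readout d (x t) j - readout e (w t) j)\<^sup>2) \<le> (2 * s)\<^sup>2 * ?U"
      using one_step_error[of e d s x w] less.prems w const \<open>0 < s\<close> \<open>e < d\<close>
      by (simp add: power_mult_distrib)
    moreover have "integral {0..T} (\<lambda>t. \<Sum>j<p. (readout e (w t) j - readout r (y t) j)\<^sup>2)
        \<le> (2 * \<Sum>(\<sigma> ` {r..<e}))\<^sup>2 * ?U"
      using less.IH[of e w] False e(1) \<open>e < d\<close> less.prems(2) w by simp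
    ultimately have "integral {0..T} (\<lambda>t. \<Sum>j<p. (readout d (x t) j - readout r (y t) j)\<^sup>2)
        \<le> (2 * s + 2 * \<Sum>(\<sigma> ` {r..<e}))\<^sup>2 * ?U"
      using \<open>0 < s\<close> \<open>0 < \<Sum>(\<sigma> ` {r..<e})\<close> less.prems(3) assms(5) w
      by (intro readout_error_triangle[of d x e w r y]) auto
    then show ?thesis by (simp add: sum distrib_left)
  qed
qed

end


section \<open>Passage from matrices to coordinates\<close>

lemma scalar_prod_sum: "w \<in> carrier_vec d \<Longrightarrow> v \<bullet> w = (\<Sum>i<d. v $ i * w $ i)"
  by (simp add: scalar_prod_def atLeast0LessThan)

lemma mult_mat_vec_index_sum:
  assumes "M \<in> carrier_mat nr nc" "v \<in> carrier_vec nc" "i < nr"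
  shows "(M *\<^sub>v v) $ i = (\<Sum>l<nc. M $$ (i, l) * v $ l)"
  using assms by (auto simp: scalar_prod_def atLeast0LessThan intro!: sum.cong)

lemma eucl_norm_square:
  assumes "v \<in> carrier_vec d"
  shows "(eucl_norm v)\<^sup>2 = (\<Sum>i<d. (v $ i)\<^sup>2)"
proof -
  have "v \<bullet> v = (\<Sum>i<d. (v $ i)\<^sup>2)"
    by (simp add: scalar_prod_sum[OF assms] power2_eq_square)
  then show ?thesis
    by (simp add: eucl_norm_def sum_nonneg)
qed

lemma mat_diag_mult_vec:
  fixes w :: "nat \<Rightarrow> real"
  assumes "v \<in> carrier_vec n"
  shows "mat_diag n w *\<^sub>v v = Matrix.vec n (\<lambda>i. w i * v $ i)"
proof (rule eq_vecI)
  fix i assume "i < dim_vec (Matrix.vec n (\<lambda>i. w i * v $ i))"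
  then have i: "i < n" by simp
  have "(mat_diag n w *\<^sub>v v) $ i = (\<Sum>l<n. (if i = l then w l else 0) * v $ l)"
    unfolding mult_mat_vec_index_sum[OF mat_diag_dim assms i]
    using i by (intro sum.cong) (auto simp: mat_diag_def)
  also have "\<dots> = (\<Sum>l<n. if i = l then w l * v $ l else 0)"
    by (intro sum.cong) auto
  also have "\<dots> = w i * v $ i"
    using i by simp
  finally show "(mat_diag n w *\<^sub>v v) $ i = Matrix.vec n (\<lambda>i. w i * v $ i) $ i"
    using i by simp
qed (use assms in \<open>simp add: mat_diag_def\<close>)

lemma mat_diag_scalar_prod:
  fixes w :: "nat \<Rightarrow> real"
  assumes "v \<in> carrier_vec n"
  shows "x \<bullet> (mat_diag n w *\<^sub>v v) = (\<Sum>i<n. w i * x $ i * v $ i)"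
  unfolding mat_diag_mult_vec[OF assms] by (simp add: scalar_prod_sum[of _ n] mult_ac)

text \<open>\<open>mat_inverse\<close> is defined by elimination, so its result is identified
  abstractly: invertibility excludes \<open>None\<close>, and the right inverse found must equal the
  left inverse \<open>?E\<close>.\<close>

lemma mat_inverse_mat_diag:
  fixes \<sigma> :: "nat \<Rightarrow> real"
  assumes "\<And>i. i < n \<Longrightarrow> \<sigma> i \<noteq> 0"
  shows "the (mat_inverse (mat_diag n \<sigma>)) = mat_diag n (\<lambda>i. 1 / \<sigma> i)"
proof -
  let ?D = "mat_diag n \<sigma>" and ?E = "mat_diag n (\<lambda>i. 1 / \<sigma> i)"
  have one: "mat_diag n (\<lambda>i. \<sigma> i * (1 / \<sigma> i)) = 1\<^sub>m n" "mat_diag n (\<lambda>i. 1 / \<sigma> i * \<sigma> i) = 1\<^sub>m n"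
    using assms by (auto simp: mat_diag_def intro!: eq_matI)
  then have DE: "?D * ?E = 1\<^sub>m n" "?E * ?D = 1\<^sub>m n"
    by (simp_all only: mat_diag_diag)
  then have "?D \<in> Units (ring_mat TYPE(real) n ())"
    unfolding Units_def ring_mat_def by (auto intro!: bexI[of _ ?E])
  then obtain X where X: "mat_inverse ?D = Some X"
    using mat_inverse(1)[OF mat_diag_dim, of n \<sigma> "()"] by (cases "mat_inverse ?D") auto
  then have "?D * X = 1\<^sub>m n" "X \<in> carrier_mat n n"
    using mat_inverse(2)[OF mat_diag_dim, of n \<sigma> X] by auto
  have "X = (?E * ?D) * X" using DE \<open>X \<in> carrier_mat n n\<close> by simp
  also have "\<dots> = ?E * (?D * X)" using \<open>X \<in> carrier_mat n n\<close> 
    by (rule assoc_mult_mat[OF mat_diag_dim mat_diag_dim])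
  also have "\<dots> = ?E" using \<open>?D * X = 1\<^sub>m n\<close> by (simp add: right_mult_one_mat[OF mat_diag_dim])
  finally show ?thesis using X by simp
qed

lemma mat_sum_scalar_prod:
  fixes F :: "nat \<Rightarrow> real mat"
  assumes F: "\<And>q. q < m \<Longrightarrow> F q \<in> carrier_mat n n" and v: "v \<in> carrier_vec n"
  shows "x \<bullet> (mat_sum n n F m *\<^sub>v v) = (\<Sum>q<m. x \<bullet> (F q *\<^sub>v v))"
proof -
  have S: "mat_sum n n F m \<in> carrier_mat n n" by (simp add: mat_sum_def)
  have "(mat_sum n n F m *\<^sub>v v) $ i = (\<Sum>q<m. (F q *\<^sub>v v) $ i)" if "i < n" for i
  proof -
    have "(mat_sum n n F m *\<^sub>v v) $ i = (\<Sum>l<n. \<Sum>q<m. F q $$ (i, l) * v $ l)"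
      unfolding mult_mat_vec_index_sum[OF S v that]
      using that by (intro sum.cong) (auto simp: mat_sum_def sum_distrib_right)
    also have "\<dots> = (\<Sum>q<m. \<Sum>l<n. F q $$ (i, l) * v $ l)" by (rule sum.swap)
    also have "\<dots> = (\<Sum>q<m. (F q *\<^sub>v v) $ i)"
      by (rule sum.cong[OF refl]) (simp only: mult_mat_vec_index_sum[OF F v that] lessThan_iff)
    finally show ?thesis .
  qed
  then have "x \<bullet> (mat_sum n n F m *\<^sub>v v) = (\<Sum>i<n. \<Sum>q<m. x $ i * (F q *\<^sub>v v) $ i)"
    using mult_mat_vec_carrier[OF S v] by (simp add: scalar_prod_sum[of _ n] sum_distrib_left)
  also have "\<dots> = (\<Sum>q<m. \<Sum>i<n. x $ i * (F q *\<^sub>v v) $ i)" by (rule sum.swap)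
  also have "\<dots> = (\<Sum>q<m. x \<bullet> (F q *\<^sub>v v))"
  proof (rule sum.cong[OF refl])
    fix q assume "q \<in> {..<m}"
    then have "F q *\<^sub>v v \<in> carrier_vec n" using F[of q] v by simp
    then show "(\<Sum>i<n. x $ i * (F q *\<^sub>v v) $ i) = x \<bullet> (F q *\<^sub>v v)"
      by (simp only: scalar_prod_sum)
  qed
  finally show ?thesis .
qed

lemma transpose_scalar_prod:
  fixes M :: "real mat"
  assumes "M \<in> carrier_mat nr nc" "x \<in> carrier_vec nc" "y \<in> carrier_vec nr"
  shows "x \<bullet> (transpose_mat M *\<^sub>v y) = (M *\<^sub>v x) \<bullet> y"
  using transpose_vec_mult_scalar[OF assms] assms
  by (metis comm_scalar_prod mult_mat_vec_carrier transpose_carrier_mat)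

lemma loewner_leD:
  assumes "loewner_le n M1 M2" "v \<in> carrier_vec n"
  shows "v \<bullet> (M1 *\<^sub>v v) \<le> v \<bullet> (M2 *\<^sub>v v)"
proof -
  have M: "M1 \<in> carrier_mat n n" "M2 \<in> carrier_mat n n" and "0 \<le> v \<bullet> ((M2 - M1) *\<^sub>v v)"
    using assms by (auto simp: loewner_le_def symmetric_mat_def psd_mat_def)
  then show ?thesis
    using assms(2) by (simp add: minus_mult_distrib_mat_vec[of _ n n] scalar_prod_minus_distrib[of _ n])
qed

text \<open>Moving transposes to the other argument gives the same value for \<open>A^T W\<close>
  and \<open>W A\<close>, hence the factor 2; since \<open>W\<close> is diagonal,
  \<open>N_q^T W N_q\<close> becomes a weighted sum of squares.\<close>

lemma lyapunov_operator_scalar_prod: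
  fixes w :: "nat \<Rightarrow> real"
  assumes A: "A \<in> carrier_mat n n" and N: "\<And>q. q < m \<Longrightarrow> N q \<in> carrier_mat n n"
    and z: "z \<in> carrier_vec n"
  shows "z \<bullet> ((transpose_mat A * mat_diag n w + mat_diag n w * A
      + mat_sum n n (\<lambda>q. transpose_mat (N q) * mat_diag n w * N q) m) *\<^sub>v z)
    = 2 * (\<Sum>i<n. w i * z $ i * (A *\<^sub>v z) $ i) + (\<Sum>q<m. \<Sum>i<n. w i * ((N q *\<^sub>v z) $ i)\<^sup>2)"
proof -
  let ?W = "mat_diag n w" and ?S = "mat_sum n n (\<lambda>q. transpose_mat (N q) * mat_diag n w * N q) m"
  have W: "?W \<in> carrier_mat n n" by simp
  have S: "?S \<in> carrier_mat n n" by (simp add: mat_sum_def)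
  have c: "transpose_mat A * ?W \<in> carrier_mat n n" "?W * A \<in> carrier_mat n n"
    "transpose_mat A * ?W + ?W * A \<in> carrier_mat n n"
    using A mult_carrier_mat[OF _ W] mult_carrier_mat[OF W A] by (auto intro!: add_carrier_mat)
  have Az: "A *\<^sub>v z \<in> carrier_vec n" and Wz: "?W *\<^sub>v z \<in> carrier_vec n"
    by (rule mult_mat_vec_carrier[OF A z], rule mult_mat_vec_carrier[OF W z])
  have "z \<bullet> ((transpose_mat A * ?W + ?W * A + ?S) *\<^sub>v z)
      = z \<bullet> ((transpose_mat A * ?W) *\<^sub>v z) + z \<bullet> ((?W * A) *\<^sub>v z) + z \<bullet> (?S *\<^sub>v z)"
    using c S z
    by (simp add: add_mult_distrib_mat_vec[of _ n n] scalar_prod_add_distrib[of _ n]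
        mult_mat_vec_carrier[of _ n n] del: assoc_mult_mat_vec)
  also have "z \<bullet> ((transpose_mat A * ?W) *\<^sub>v z) = (A *\<^sub>v z) \<bullet> (?W *\<^sub>v z)"
    using A W z Wz transpose_scalar_prod[OF A z Wz] by (simp add: assoc_mult_mat_vec[of _ n n _ n])
  also have "\<dots> = (\<Sum>i<n. w i * z $ i * (A *\<^sub>v z) $ i)"
    unfolding mat_diag_scalar_prod[OF z] by (simp add: mult_ac)
  also have "z \<bullet> ((?W * A) *\<^sub>v z) = (\<Sum>i<n. w i * z $ i * (A *\<^sub>v z) $ i)"
    using A W z by (simp add: assoc_mult_mat_vec[of _ n n _ n] mat_diag_scalar_prod[OF Az])
  also have "z \<bullet> (?S *\<^sub>v z) = (\<Sum>q<m. \<Sum>i<n. w i * ((N q *\<^sub>v z) $ i)\<^sup>2)"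
  proof -
    have "z \<bullet> (?S *\<^sub>v z) = (\<Sum>q<m. z \<bullet> ((transpose_mat (N q) * ?W * N q) *\<^sub>v z))"
    proof (rule mat_sum_scalar_prod[OF _ z])
      show "transpose_mat (N q) * ?W * N q \<in> carrier_mat n n" if "q < m" for q
        using N[OF that] by (intro mult_carrier_mat[of _ n n] W) simp_all
    qed
    also have "\<dots> = (\<Sum>q<m. \<Sum>i<n. w i * ((N q *\<^sub>v z) $ i)\<^sup>2)"
    proof (rule sum.cong[OF refl])
      fix q assume "q \<in> {..<m}"
      then have Nq: "N q \<in> carrier_mat n n" using N by simp
      then have Nz: "N q *\<^sub>v z \<in> carrier_vec n" using z by simp
      then have WNz: "?W *\<^sub>v (N q *\<^sub>v z) \<in> carrier_vec n" by (rule mult_mat_vec_carrier[OF W])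
      have t: "transpose_mat (N q) * ?W \<in> carrier_mat n n" "transpose_mat (N q) \<in> carrier_mat n n"
        using Nq W by auto
      have "(transpose_mat (N q) * ?W * N q) *\<^sub>v z = transpose_mat (N q) *\<^sub>v (?W *\<^sub>v (N q *\<^sub>v z))"
        using t Nq Nz z W assoc_mult_mat_vec[OF t(1) Nq z] assoc_mult_mat_vec[OF t(2) W Nz] by simp
      then show "z \<bullet> ((transpose_mat (N q) * ?W * N q) *\<^sub>v z) = (\<Sum>i<n. w i * ((N q *\<^sub>v z) $ i)\<^sup>2)"
        using transpose_scalar_prod[OF Nq z WNz]
        by (simp add: mat_diag_scalar_prod[OF Nz] power2_eq_square mult.assoc)
    qed
    finally show ?thesis .
  qed
  finally show ?thesis by simp
qed

lemma bilinear_rhs_index: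
  assumes "A \<in> carrier_mat d d" "B \<in> carrier_mat d m" "\<And>q. q < m \<Longrightarrow> N q \<in> carrier_mat d d"
    and "v \<in> carrier_vec m" "z \<in> carrier_vec d" "i < d"
  shows "bilinear_rhs d m A B N v z $ i = (\<Sum>l<d. A $$ (i, l) * z $ l)
    + (\<Sum>q<m. v $ q * (\<Sum>l<d. N q $$ (i, l) * z $ l)) + (\<Sum>q<m. B $$ (i, q) * v $ q)"
proof -
  have N: "(\<lambda>q. (v $ q) \<cdot>\<^sub>v (N q *\<^sub>v z)) \<in> {..<m} \<rightarrow> carrier_vec d"
    using assms by (auto intro!: smult_carrier_vec[THEN iffD2] mult_mat_vec_carrier[of _ d d])
  have "finsum_vec TYPE(real) d (\<lambda>q. (v $ q) \<cdot>\<^sub>v (N q *\<^sub>v z)) {..<m} $ i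
      = (\<Sum>q<m. ((v $ q) \<cdot>\<^sub>v (N q *\<^sub>v z)) $ i)"
    by (rule index_finsum_vec[OF _ assms(6) N]) simp
  also have "\<dots> = (\<Sum>q<m. v $ q * (\<Sum>l<d. N q $$ (i, l) * z $ l))"
  proof (rule sum.cong[OF refl])
    fix q assume "q \<in> {..<m}"
    then have Nq: "N q \<in> carrier_mat d d" using assms(3) by simp
    then have "((v $ q) \<cdot>\<^sub>v (N q *\<^sub>v z)) $ i = v $ q * (N q *\<^sub>v z) $ i"
      using assms(6) by simp
    then show "((v $ q) \<cdot>\<^sub>v (N q *\<^sub>v z)) $ i = v $ q * (\<Sum>l<d. N q $$ (i, l) * z $ l)"
      by (simp only: mult_mat_vec_index_sum[OF Nq assms(5,6)])
  qed
  finally have f: "finsum_vec TYPE(real) d (\<lambda>q. (v $ q) \<cdot>\<^sub>v (N q *\<^sub>v z)) {..<m} $ i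
    = (\<Sum>q<m. v $ q * (\<Sum>l<d. N q $$ (i, l) * z $ l))" .
  have "dim_vec (finsum_vec TYPE(real) d (\<lambda>q. (v $ q) \<cdot>\<^sub>v (N q *\<^sub>v z)) {..<m}) = d"
    using finsum_vec_closed[OF N] by simp
  then have "bilinear_rhs d m A B N v z $ i = (A *\<^sub>v z) $ i + (B *\<^sub>v v) $ i
      + finsum_vec TYPE(real) d (\<lambda>q. (v $ q) \<cdot>\<^sub>v (N q *\<^sub>v z)) {..<m} $ i"
    unfolding bilinear_rhs_def using assms by (simp del: index_mult_mat_vec)
  then show ?thesis
    unfolding f mult_mat_vec_index_sum[OF assms(1,5,6)] mult_mat_vec_index_sum[OF assms(2,4,6)]
    by simp
qed

section \<open>Caratheodory solutions as primitives\<close>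

lemma absolutely_continuous_on_subinterval:
  assumes "absolutely_continuous_on a b f" "a \<le> c" "d \<le> b"
  shows "absolutely_continuous_on c d f"
  unfolding absolutely_continuous_on_def
proof (intro allI impI)
  fix \<epsilon> :: real assume "0 < \<epsilon>"
  then obtain \<delta> where "0 < \<delta>" and \<delta>: "\<And>D :: (real \<times> real) set. finite D \<Longrightarrow>
      \<forall>(s, t) \<in> D. a \<le> s \<and> s \<le> t \<and> t \<le> b \<Longrightarrow>
      disjoint_family_on (\<lambda>(s, t). {s<..<t}) D \<Longrightarrow>
      (\<Sum>(s, t) \<in> D. t - s) < \<delta> \<Longrightarrow> (\<Sum>(s, t) \<in> D. \<bar>f t - f s\<bar>) < \<epsilon>"
    using assms(1)[unfolded absolutely_continuous_on_def, rule_format, of \<epsilon>] by (auto 4 0)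
  show "\<exists>\<delta>>0. \<forall>D :: (real \<times> real) set. finite D \<longrightarrow>
      (\<forall>(s, t) \<in> D. c \<le> s \<and> s \<le> t \<and> t \<le> d) \<longrightarrow>
      disjoint_family_on (\<lambda>(s, t). {s<..<t}) D \<longrightarrow>
      (\<Sum>(s, t) \<in> D. t - s) < \<delta> \<longrightarrow> (\<Sum>(s, t) \<in> D. \<bar>f t - f s\<bar>) < \<epsilon>"
  proof (intro exI[of _ \<delta>] conjI allI impI \<open>0 < \<delta>\<close>)
    fix D :: "(real \<times> real) set"
    assume "finite D" and D: "\<forall>(s, t) \<in> D. c \<le> s \<and> s \<le> t \<and> t \<le> d"
      and "disjoint_family_on (\<lambda>(s, t). {s<..<t}) D" "(\<Sum>(s, t) \<in> D. t - s) < \<delta>"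
    moreover have "\<forall>(s, t) \<in> D. a \<le> s \<and> s \<le> t \<and> t \<le> b"
      using D assms(2,3) by fastforce
    ultimately show "(\<Sum>(s, t) \<in> D. \<bar>f t - f s\<bar>) < \<epsilon>"
      by (intro \<delta>)
  qed
qed

text \<open>The right-hand side contains the state, so its boundedness has to be earned: the
  fundamental theorem first shows that it is integrable with the state as indefinite integral, thus
  the state is continuous and bounded, and only then is the right-hand side bounded and
  measurable.\<close>

lemma (in bilinear_system) bilinear_state_truncation:
  assumes A: "A \<in> carrier_mat d d" "\<And>i l. i < d \<Longrightarrow> l < d \<Longrightarrow> A $$ (i, l) = a i l"
    and B: "B \<in> carrier_mat d m" "\<And>i q. i < d \<Longrightarrow> q < m \<Longrightarrow> B $$ (i, q) = b i q"
    and M: "\<And>q. q < m \<Longrightarrow> M q \<in> carrier_mat d d"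
      "\<And>q i l. q < m \<Longrightarrow> i < d \<Longrightarrow> l < d \<Longrightarrow> M q $$ (i, l) = N q i l"
    and v: "\<And>t. t \<in> {0..T} \<Longrightarrow> v t \<in> carrier_vec m"
      "\<And>t q. t \<in> {0..T} \<Longrightarrow> q < m \<Longrightarrow> v t $ q = u t q"
    and state: "bilinear_state d m T A B M v x"
  shows "truncation d (\<lambda>t i. x t $ i)"
  unfolding truncation_def
proof (intro allI impI)
  fix i assume i: "i < d"
  define g where "g i t = drift d (u t) (\<lambda>i. x t $ i) i + forcing (u t) i" for i t
  have x: "x t \<in> carrier_vec d" if "t \<in> {0..T}" for t
    using state that by (simp add: bilinear_state_def)
  have rhs: "bilinear_rhs d m A B M (v t) (x t) $ j = g j t" if "j < d" "t \<in> {0..T}" for j t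
    using A(2) B(2) M(2) v(2) that
    by (simp add: bilinear_rhs_index[OF A(1) B(1) M(1) v(1) x] g_def drift_def forcing_def)
  have int: "((g j) has_integral x t $ j) {0..t}" if j: "j < d" and t: "t \<in> {0..T}" for j t
  proof -
    have ac: "absolutely_continuous_on 0 t (\<lambda>t. x t $ j)"
      by (rule absolutely_continuous_on_subinterval) (use state j t in \<open>auto simp: bilinear_state_def\<close>)
    have "AE s in lebesgue_on {0..T}. ((\<lambda>s. x s $ j) has_real_derivative g j s) (at s within {0..T})"
    proof -
      have "AE s in lebesgue_on {0..T}. s \<in> {0..T}"
        using AE_space[of "lebesgue_on {0..T}"] by simp
      moreover have "AE s in lebesgue_on {0..T}. \<forall>j<d. ((\<lambda>s. x s $ j) has_real_derivative
          bilinear_rhs d m A B M (v s) (x s) $ j) (at s within {0..T})"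
        using state by (simp add: bilinear_state_def)
      ultimately show ?thesis
        by eventually_elim (use rhs j in auto)
    qed
    then have "AE s in lebesgue. s \<in> {0..T} \<longrightarrow>
        ((\<lambda>s. x s $ j) has_real_derivative g j s) (at s within {0..T})"
      by (simp add: AE_restrict_space_iff)
    then have "AE s in lebesgue. s \<in> {0..t} \<longrightarrow>
        ((\<lambda>s. x s $ j) has_real_derivative g j s) (at s within {0..t})"
      by eventually_elim (use t in \<open>auto intro: has_field_derivative_subset\<close>)
    then have "AE s in lebesgue_on {0..t}.
        ((\<lambda>s. x s $ j) has_real_derivative g j s) (at s within {0..t})"
      by (simp add: AE_restrict_space_iff)
    then have "((g j) has_integral x t $ j - x 0 $ j) {0..t}"
      using ac t by (intro has_integral_absolutely_continuous) auto
    moreover have "x 0 $ j = 0"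
      using state j by (simp add: bilinear_state_def)
    ultimately show ?thesis by simp
  qed
  have x_bm: "bounded_measurable T (\<lambda>t. x t $ j)" if "j < d" for j
  proof (rule bounded_measurable_continuous)
    have "continuous_on {0..T} (\<lambda>t. integral {0..t} (g j))"
      using int[OF that, of T] T_nonneg by (intro indefinite_integral_continuous_1) (auto intro: has_integral_integrable)
    then show "continuous_on {0..T} (\<lambda>t. x t $ j)"
      by (rule continuous_on_eq) (use int[OF that] in \<open>auto intro: integral_unique\<close>)
  qed
  have "bounded_measurable T (g i)"
    unfolding g_def[abs_def] drift_def
    by (intro bounded_measurable_intros x_bm u_bounded_measurable forcing_bounded_measurable) auto
  then show "primitive T (\<lambda>t. x t $ i) (\<lambda>t. drift d (u t) (\<lambda>i. x t $ i) i + forcing (u t) i)"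
    using integral_unique[OF int[OF i]] by (simp add: primitive_def g_def[abs_def])
qed

lemma (in bilinear_system) lyapunov_form_eq_scalar_prod:
  assumes A: "A \<in> carrier_mat n n" "\<And>i l. i < n \<Longrightarrow> l < n \<Longrightarrow> A $$ (i, l) = a i l"
    and M: "\<And>q. q < m \<Longrightarrow> M q \<in> carrier_mat n n"
      "\<And>q i l. q < m \<Longrightarrow> i < n \<Longrightarrow> l < n \<Longrightarrow> M q $$ (i, l) = N q i l"
  defines "Ak \<equiv> A + (k\<^sup>2 / 2) \<cdot>\<^sub>m 1\<^sub>m n"
  shows "lyapunov_form n w z = Matrix.vec n z \<bullet> ((transpose_mat Ak * mat_diag n w + mat_diag n w * Ak
      + mat_sum n n (\<lambda>q. transpose_mat (M q) * mat_diag n w * M q) m) *\<^sub>v Matrix.vec n z)"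
proof -
  let ?z = "Matrix.vec n z"
  have z: "?z \<in> carrier_vec n" by simp
  have Ak: "Ak \<in> carrier_mat n n" using A by (simp add: Ak_def)
  have Mz: "(M q *\<^sub>v ?z) $ i = (\<Sum>l<n. N q i l * z l)" if "q < m" "i < n" for q i
    unfolding mult_mat_vec_index_sum[OF M(1)[OF that(1)] z that(2)]
    using M(2) that by (intro sum.cong) auto
  have Az: "(Ak *\<^sub>v ?z) $ i = (\<Sum>l<n. a i l * z l) + k\<^sup>2 / 2 * z i" if "i < n" for i
  proof -
    have "Ak *\<^sub>v ?z = A *\<^sub>v ?z + ((k\<^sup>2 / 2) \<cdot>\<^sub>m 1\<^sub>m n) *\<^sub>v ?z"
      unfolding Ak_def by (rule add_mult_distrib_mat_vec[OF A(1) _ z]) simp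
    moreover have "((k\<^sup>2 / 2) \<cdot>\<^sub>m 1\<^sub>m n) *\<^sub>v ?z = (k\<^sup>2 / 2) \<cdot>\<^sub>v ?z"
      by (intro eq_vecI) auto
    moreover have "(A *\<^sub>v ?z) $ i = (\<Sum>l<n. a i l * z l)"
      unfolding mult_mat_vec_index_sum[OF A(1) z that] using A(2) that by (intro sum.cong) auto
    ultimately show ?thesis using that A(1) by (simp del: index_mult_mat_vec)
  qed
  have "2 * (\<Sum>i<n. w i * ?z $ i * (Ak *\<^sub>v ?z) $ i)
      = 2 * (\<Sum>i<n. w i * z i * ((\<Sum>l<n. a i l * z l) + k\<^sup>2 / 2 * z i))"
    using Az by simp
  also have "\<dots> = 2 * (\<Sum>i<n. w i * z i * (\<Sum>l<n. a i l * z l)) + k\<^sup>2 * (\<Sum>i<n. w i * (z i)\<^sup>2)"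
    by (simp add: distrib_left sum.distrib sum_distrib_left power2_eq_square mult_ac)
  finally show ?thesis
    using Mz lyapunov_operator_scalar_prod[where w = w and N = M, OF Ak M(1) z]
    by (simp add: lyapunov_form_def)
qed

text \<open>Connects the Lebesgue integral in the norm with the gauge integral used in the
  estimates.\<close>

lemma L2_norm_on_square:
  assumes "\<And>t. t \<in> {0..T} \<Longrightarrow> f t \<in> carrier_vec d"
    and "\<And>i. i < d \<Longrightarrow> bounded_measurable T (\<lambda>t. f t $ i)"
  shows "L2_norm_on T f = sqrt (integral {0..T} (\<lambda>t. \<Sum>i<d. (f t $ i)\<^sup>2))"
proof -
  let ?g = "\<lambda>t. \<Sum>i<d. (f t $ i)\<^sup>2"
  have g: "?g absolutely_integrable_on {0..T}"
    using assms(2) by (intro bounded_measurable_absolutely_integrable bounded_measurable_intros) auto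
  have "(\<integral>t. (eucl_norm (f t))\<^sup>2 \<partial>lebesgue_on {0..T}) = (\<integral>t. ?g t \<partial>lebesgue_on {0..T})"
    by (rule Bochner_Integration.integral_cong) (use assms(1) in \<open>auto simp: eucl_norm_square\<close>)
  also have "\<dots> = integral {0..T} ?g"
    using g by (intro lebesgue_integral_eq_integral) (auto simp: absolutely_integrable_imp_integrable)
  finally show ?thesis by (simp add: L2_norm_on_def)
qed

theorem theorem4p1:
  fixes n m p r :: nat and k T :: real
    and A A11 A12 A21 A22 B B1 B2 C C1 C2 \<Sigma> \<Sigma>1 \<Sigma>2 :: "real mat"
    and N N11 N12 N21 N22 :: "nat \<Rightarrow> real mat"
    and \<sigma> :: "nat \<Rightarrow> real" and \<sigma>t :: "real list"
    and u y yr :: "real \<Rightarrow> real vec"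
  defines "Ak \<equiv> A + (k\<^sup>2 / 2) \<cdot>\<^sub>m 1\<^sub>m n"
    and "\<Sigma>inv \<equiv> the (mat_inverse \<Sigma>)"
  assumes "1 \<le> n" "1 \<le> m" "1 \<le> p" "1 \<le> r" "r < n" "0 < k" "0 < T"
    and "A \<in> carrier_mat n n" "B \<in> carrier_mat n m" "C \<in> carrier_mat p n"
    and "\<And>i. i < m \<Longrightarrow> N i \<in> carrier_mat n n"
    and spectrum: "spectrum (map_mat complex_of_real
          (1\<^sub>m n \<otimes>\<^sub>m Ak + Ak \<otimes>\<^sub>m 1\<^sub>m n + mat_sum (n * n) (n * n) (\<lambda>i. N i \<otimes>\<^sub>m N i) m))
          \<subseteq> {z. Re z < 0}"
    and \<Sigma>: "\<Sigma> = mat_diag n \<sigma>"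
    and "\<And>i j. i \<le> j \<Longrightarrow> j < n \<Longrightarrow> \<sigma> j \<le> \<sigma> i" "\<And>i. i < n \<Longrightarrow> 0 < \<sigma> i"
    and gramian_P: "loewner_le n
          (transpose_mat Ak * \<Sigma>inv + \<Sigma>inv * Ak
             + mat_sum n n (\<lambda>i. transpose_mat (N i) * \<Sigma>inv * N i) m)
          (- (\<Sigma>inv * B * transpose_mat B * \<Sigma>inv))"
    and gramian_Q: "loewner_le n
          (transpose_mat Ak * \<Sigma> + \<Sigma> * Ak
             + mat_sum n n (\<lambda>i. transpose_mat (N i) * \<Sigma> * N i) m)
          (- (transpose_mat C * C))"
    and "\<Sigma>1 = mat_diag r \<sigma>" "\<Sigma>2 = mat_diag (n - r) (\<lambda>i. \<sigma> (r + i))"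
        "\<Sigma> = diag_block_mat [\<Sigma>1, \<Sigma>2]"
    and "distinct \<sigma>t" "set \<sigma>t = set (diag_mat \<Sigma>2)"
    and "A11 \<in> carrier_mat r r" "A12 \<in> carrier_mat r (n - r)"
        "A21 \<in> carrier_mat (n - r) r" "A22 \<in> carrier_mat (n - r) (n - r)"
        "A = four_block_mat A11 A12 A21 A22"
    and "B1 \<in> carrier_mat r m" "B2 \<in> carrier_mat (n - r) m" "B = B1 @\<^sub>r B2"
    and "\<And>i. i < m \<Longrightarrow> N11 i \<in> carrier_mat r r"
        "\<And>i. i < m \<Longrightarrow> N12 i \<in> carrier_mat r (n - r)"
        "\<And>i. i < m \<Longrightarrow> N21 i \<in> carrier_mat (n - r) r"
        "\<And>i. i < m \<Longrightarrow> N22 i \<in> carrier_mat (n - r) (n - r)"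
        "\<And>i. i < m \<Longrightarrow> N i = four_block_mat (N11 i) (N12 i) (N21 i) (N22 i)"
    and "C1 \<in> carrier_mat p r" "C2 \<in> carrier_mat p (n - r)" "C = C1 @\<^sub>c C2"
    and control: "square_integrable m T u" "\<And>t. t \<in> {0..T} \<Longrightarrow> eucl_norm (u t) \<le> k"
    and full: "bilinear_output n m T A B N C u y"
    and reduced: "bilinear_output r m T A11 B1 N11 C1 u yr"
  shows "L2_norm_on T (\<lambda>t. y t - yr t) \<le> 2 * sum_list \<sigma>t * L2_norm_on T u"
proof -
  note \<sigma>_decr = \<open>\<And>i j. i \<le> j \<Longrightarrow> j < n \<Longrightarrow> \<sigma> j \<le> \<sigma> i\<close>
    and \<sigma>_pos = \<open>\<And>i. i < n \<Longrightarrow> 0 < \<sigma> i\<close>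
    and A = \<open>A \<in> carrier_mat n n\<close> and B = \<open>B \<in> carrier_mat n m\<close> and C = \<open>C \<in> carrier_mat p n\<close>
    and N = \<open>\<And>i. i < m \<Longrightarrow> N i \<in> carrier_mat n n\<close>
    and A11 = \<open>A11 \<in> carrier_mat r r\<close> and B1 = \<open>B1 \<in> carrier_mat r m\<close> and C1 = \<open>C1 \<in> carrier_mat p r\<close>
    and N11 = \<open>\<And>i. i < m \<Longrightarrow> N11 i \<in> carrier_mat r r\<close>
  have u: "u t \<in> carrier_vec m" if "t \<in> {0..T}" for t
    using control(1) that by (simp add: square_integrable_def)
  have u_norm: "(eucl_norm (u t))\<^sup>2 = (\<Sum>q<m. (u t $ q)\<^sup>2)" if "t \<in> {0..T}" for t
    by (rule eucl_norm_square[OF u[OF that]])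
  have u_le: "(\<Sum>q<m. (u t $ q)\<^sup>2) \<le> k\<^sup>2" if "t \<in> {0..T}" for t
  proof -
    have "0 \<le> eucl_norm (u t)" by (simp add: eucl_norm_def scalar_prod_sum[OF u[OF that]] sum_nonneg)
    then have "(eucl_norm (u t))\<^sup>2 \<le> k\<^sup>2" using control(2)[OF that] by (rule power_mono[rotated])
    then show ?thesis by (simp add: u_norm[OF that])
  qed
  have u_bm: "bounded_measurable T (\<lambda>t. u t $ q)" if "q < m" for q
    unfolding bounded_measurable_def
  proof
    show "(\<lambda>t. u t $ q) \<in> borel_measurable (lebesgue_on {0..T})"
      using control(1) that by (simp add: square_integrable_def)
    have "\<bar>u t $ q\<bar> \<le> k" if "t \<in> {0..T}" for t
    proof -
      have "(u t $ q)\<^sup>2 \<le> (\<Sum>q<m. (u t $ q)\<^sup>2)" using \<open>q < m\<close> by (intro member_le_sum) auto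
      with u_le[OF that] have "(u t $ q)\<^sup>2 \<le> k\<^sup>2" by simp
      then show ?thesis using \<open>0 < k\<close> by (simp add: power2_le_iff_abs_le)
    qed
    then show "\<exists>K. \<forall>t\<in>{0..T}. \<bar>u t $ q\<bar> \<le> K" by blast
  qed
  interpret bilinear_system n m p T k "\<lambda>i l. A $$ (i, l)" "\<lambda>i q. B $$ (i, q)" "\<lambda>j i. C $$ (j, i)"
    "\<lambda>q i l. N q $$ (i, l)" "\<lambda>t q. u t $ q"
    using \<open>0 < T\<close> u_bm u_le by unfold_locales auto
  have \<Sigma>inv: "\<Sigma>inv = mat_diag n (\<lambda>i. 1 / \<sigma> i)"
    unfolding \<Sigma>inv_def \<Sigma> using \<sigma>_pos by (intro mat_inverse_mat_diag) (auto simp: less_le)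
  have lyap: "lyapunov_form n w z = Matrix.vec n z \<bullet> ((transpose_mat Ak * mat_diag n w + mat_diag n w * Ak
      + mat_sum n n (\<lambda>q. transpose_mat (N q) * mat_diag n w * N q) m) *\<^sub>v Matrix.vec n z)" for w z
    unfolding Ak_def by (rule lyapunov_form_eq_scalar_prod[OF A _ N]) simp_all
  \<comment> \<open>A second interpretation, since \<open>lyap\<close>, which translates the Gramian
    inequalities, is itself stated with the \<open>lyapunov_form\<close> of the first.\<close>
  interpret balanced_bilinear_system n m p T k "\<lambda>i l. A $$ (i, l)" "\<lambda>i q. B $$ (i, q)"
    "\<lambda>j i. C $$ (j, i)" "\<lambda>q i l. N q $$ (i, l)" "\<lambda>t q. u t $ q" \<sigma>
  proof unfold_locales
    show "0 < \<sigma> i" if "i < n" for i by (rule \<sigma>_pos[OF that])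
    fix z :: "nat \<Rightarrow> real"
    let ?z = "Matrix.vec n z"
    have z: "?z \<in> carrier_vec n" by simp
    have Cz: "C *\<^sub>v ?z \<in> carrier_vec p" using C by simp
    have "lyapunov_form n \<sigma> z \<le> ?z \<bullet> (- (transpose_mat C * C) *\<^sub>v ?z)"
      unfolding lyap by (rule loewner_leD[OF gramian_Q[unfolded \<Sigma>] z])
    also have "\<dots> = - (?z \<bullet> (transpose_mat C *\<^sub>v (C *\<^sub>v ?z)))"
      using C by (simp add: assoc_mult_mat_vec[of _ n p _ n])
    also have "?z \<bullet> (transpose_mat C *\<^sub>v (C *\<^sub>v ?z)) = (\<Sum>j<p. (C *\<^sub>v ?z) $ j * (C *\<^sub>v ?z) $ j)"
      unfolding transpose_scalar_prod[OF C z Cz] by (rule scalar_prod_sum[OF Cz])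
    also have "\<dots> = (\<Sum>j<p. (readout n z j)\<^sup>2)"
      using mult_mat_vec_index_sum[OF C z]
      by (intro sum.cong) (simp_all add: readout_def power2_eq_square del: index_mult_mat_vec)
    finally show "lyapunov_form n \<sigma> z \<le> - (\<Sum>j<p. (readout n z j)\<^sup>2)" .
    \<comment> \<open>The form of \<open>\<Sigma>^-1 B B^T \<Sigma>^-1\<close> at \<open>z\<close>
      is \<open>|g|^2\<close> with \<open>g = B^T \<Sigma>^-1 z\<close>. Here \<open>y\<close> is an
      auxiliary vector that shadows the output.\<close>
    define y where "y = \<Sigma>inv *\<^sub>v ?z"
    define g where "g = transpose_mat B *\<^sub>v y"
    have S: "\<Sigma>inv \<in> carrier_mat n n" by (simp add: \<Sigma>inv)
    have y: "y \<in> carrier_vec n" unfolding y_def by (rule mult_mat_vec_carrier[OF S z])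
    have Bt: "transpose_mat B \<in> carrier_mat m n" using B by simp
    have g: "g \<in> carrier_vec m" unfolding g_def by (rule mult_mat_vec_carrier[OF Bt y])
    have Bg: "B *\<^sub>v g \<in> carrier_vec n" by (rule mult_mat_vec_carrier[OF B g])
    have SB: "\<Sigma>inv * B \<in> carrier_mat n m" and SBB: "\<Sigma>inv * B * transpose_mat B \<in> carrier_mat n n"
      and SBBS: "\<Sigma>inv * B * transpose_mat B * \<Sigma>inv \<in> carrier_mat n n"
      using S B Bt by (auto intro: mult_carrier_mat)
    have "lyapunov_form n (\<lambda>i. 1 / \<sigma> i) z
        \<le> ?z \<bullet> (- (\<Sigma>inv * B * transpose_mat B * \<Sigma>inv) *\<^sub>v ?z)"
      unfolding lyap \<Sigma>inv[symmetric] by (rule loewner_leD[OF gramian_P z])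
    also have "\<dots> = - (?z \<bullet> (\<Sigma>inv *\<^sub>v (B *\<^sub>v g)))"
    proof -
      have "(\<Sigma>inv * B * transpose_mat B * \<Sigma>inv) *\<^sub>v ?z = \<Sigma>inv *\<^sub>v (B *\<^sub>v g)"
        unfolding assoc_mult_mat_vec[OF SBB S z] y_def[symmetric] assoc_mult_mat_vec[OF SB Bt y]
          g_def[symmetric] by (rule assoc_mult_mat_vec[OF S B g])
      then show ?thesis using SBBS S by simp
    qed
    also have "?z \<bullet> (\<Sigma>inv *\<^sub>v (B *\<^sub>v g)) = y \<bullet> (B *\<^sub>v g)"
      unfolding y_def \<Sigma>inv mat_diag_scalar_prod[OF Bg] mat_diag_mult_vec[OF z]
      by (simp add: scalar_prod_sum[OF Bg] del: index_mult_mat_vec)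
    also have "\<dots> = g \<bullet> g"
      using transpose_scalar_prod[OF Bt y g] by (simp add: g_def)
    also have "\<dots> = (\<Sum>q<m. (\<Sum>i<n. B $$ (i, q) * z i / \<sigma> i)\<^sup>2)"
    proof -
      have "g $ q = (\<Sum>i<n. B $$ (i, q) * z i / \<sigma> i)" if "q < m" for q
        unfolding g_def mult_mat_vec_index_sum[OF Bt y that]
        unfolding y_def \<Sigma>inv mat_diag_mult_vec[OF z] using B that by (intro sum.cong) auto
      then show ?thesis by (simp add: scalar_prod_sum[OF g] power2_eq_square)
    qed
    finally show "lyapunov_form n (\<lambda>i. 1 / \<sigma> i) z \<le> - (\<Sum>q<m. (\<Sum>i<n. B $$ (i, q) * z i / \<sigma> i)\<^sup>2)" .
  qed
  obtain x where x: "bilinear_state n m T A B N u x" and yx: "\<And>t. t \<in> {0..T} \<Longrightarrow> y t = C *\<^sub>v x t"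
    using full by (auto simp: bilinear_output_def)
  obtain xr where xr: "bilinear_state r m T A11 B1 N11 u xr"
    and yxr: "\<And>t. t \<in> {0..T} \<Longrightarrow> yr t = C1 *\<^sub>v xr t"
    using reduced by (auto simp: bilinear_output_def)
  have x_trunc: "truncation n (\<lambda>t i. x t $ i)"
    by (rule bilinear_state_truncation[OF A refl B refl N refl u refl x])
  \<comment> \<open>The reduced coefficients are leading blocks of the full ones, so the reduced
    state is a truncation within the same system.\<close>
  have xr_trunc: "truncation r (\<lambda>t i. xr t $ i)"
  proof (rule bilinear_state_truncation[OF A11 _ B1 _ N11 _ u refl xr])
    show "A11 $$ (i, l) = A $$ (i, l)" if "i < r" "l < r" for i l
      using that \<open>A = _\<close> A11 \<open>A22 \<in> _\<close> by simp
    show "B1 $$ (i, q) = B $$ (i, q)" if "i < r" "q < m" for i q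
      using that \<open>B = _\<close> B1 \<open>B2 \<in> _\<close> by (simp add: append_rows_def)
    show "N11 q $$ (i, l) = N q $$ (i, l)" if "q < m" "i < r" "l < r" for q i l
      using that N11[of q] \<open>\<And>i. i < m \<Longrightarrow> N22 i \<in> carrier_mat (n - r) (n - r)\<close>[of q]
        \<open>\<And>i. i < m \<Longrightarrow> N i = four_block_mat (N11 i) (N12 i) (N21 i) (N22 i)\<close>[of q] by simp
  qed
  have C1_index: "C1 $$ (j, i) = C $$ (j, i)" if "j < p" "i < r" for j i
    using that \<open>C = _\<close> C1 \<open>C2 \<in> _\<close> by (simp add: append_cols_def)
  define err where "err t j = readout n (\<lambda>i. x t $ i) j - readout r (\<lambda>i. xr t $ i) j" for t j
  have xc: "x t \<in> carrier_vec n" "xr t \<in> carrier_vec r" if "t \<in> {0..T}" for t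
    using x xr that by (auto simp: bilinear_state_def)
  have yc: "y t \<in> carrier_vec p" "yr t \<in> carrier_vec p" if "t \<in> {0..T}" for t
    unfolding yx[OF that] yxr[OF that] using xc[OF that] C C1 by auto
  have err: "(y t - yr t) $ j = err t j" if t: "t \<in> {0..T}" and j: "j < p" for t j
  proof -
    have "(y t - yr t) $ j = (C *\<^sub>v x t) $ j - (C1 *\<^sub>v xr t) $ j"
      using yc[OF t] j by (simp add: yx[OF t] yxr[OF t] carrier_matD[OF C1] del: index_mult_mat_vec)
    also have "\<dots> = err t j"
      unfolding mult_mat_vec_index_sum[OF C xc(1)[OF t] j] mult_mat_vec_index_sum[OF C1 xc(2)[OF t] j]
        err_def readout_def using C1_index j by simp
    finally show ?thesis .
  qed
  have err_bm: "bounded_measurable T (\<lambda>t. err t j)" for j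
    unfolding err_def
    by (intro bounded_measurable_diff readout_bounded_measurable[OF x_trunc]
        readout_bounded_measurable[OF xr_trunc])
  have "L2_norm_on T (\<lambda>t. y t - yr t) = sqrt (integral {0..T} (\<lambda>t. \<Sum>j<p. ((y t - yr t) $ j)\<^sup>2))"
    by (rule L2_norm_on_square)
      (use yc err in \<open>auto intro: bounded_measurable_cong[OF err_bm]\<close>)
  also have "integral {0..T} (\<lambda>t. \<Sum>j<p. ((y t - yr t) $ j)\<^sup>2) = integral {0..T} (\<lambda>t. \<Sum>j<p. (err t j)\<^sup>2)"
    by (rule Henstock_Kurzweil_Integration.integral_cong) (simp add: err)
  finally have L2_err: "L2_norm_on T (\<lambda>t. y t - yr t) = sqrt (integral {0..T} (\<lambda>t. \<Sum>j<p. (err t j)\<^sup>2))" .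
  have L2_u: "L2_norm_on T u = sqrt (integral {0..T} (\<lambda>t. \<Sum>q<m. (u t $ q)\<^sup>2))"
    by (rule L2_norm_on_square[OF u u_bm])
  \<comment> \<open>The diagonal of \<open>\<Sigma>2\<close> starts at index \<open>r\<close>.
    Together with distinctness this makes the list sum a sum over the image, whatever the order of
    the list.\<close>
  have "set \<sigma>t = \<sigma> ` {r..<n}"
  proof -
    have "set \<sigma>t = (\<lambda>i. \<sigma> (r + i)) ` {0..<n - r}"
      using \<open>set \<sigma>t = _\<close> \<open>\<Sigma>2 = _\<close> by (auto simp: diag_mat_def mat_diag_def)
    also have "\<dots> = \<sigma> ` ((+) r ` {0..<n - r})" by (simp only: image_image)
    also have "(+) r ` {0..<n - r} = {r..<n}" using \<open>r < n\<close> by (simp add: image_add_atLeastLessThan)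
    finally show ?thesis .
  qed
  then have sum: "sum_list \<sigma>t = \<Sum>(\<sigma> ` {r..<n})"
    using sum_list_distinct_conv_sum_set[OF \<open>distinct \<sigma>t\<close>, of id] by simp
  have sum_nonneg: "0 \<le> \<Sum>(\<sigma> ` {r..<n})"
    using \<sigma>_pos by (intro sum_nonneg) (auto simp: less_imp_le)
  have "integral {0..T} (\<lambda>t. \<Sum>j<p. (err t j)\<^sup>2)
      \<le> (2 * \<Sum>(\<sigma> ` {r..<n}))\<^sup>2 * integral {0..T} (\<lambda>t. \<Sum>q<m. (u t $ q)\<^sup>2)"
    unfolding err_def by (rule truncation_error[OF \<sigma>_decr \<open>r < n\<close> order_refl x_trunc xr_trunc])
  then have "sqrt (integral {0..T} (\<lambda>t. \<Sum>j<p. (err t j)\<^sup>2))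
      \<le> sqrt ((2 * \<Sum>(\<sigma> ` {r..<n}))\<^sup>2 * integral {0..T} (\<lambda>t. \<Sum>q<m. (u t $ q)\<^sup>2))"
    by (rule real_sqrt_le_mono)
  also have "\<dots> = 2 * sum_list \<sigma>t * L2_norm_on T u"
    using sum_nonneg by (simp add: real_sqrt_mult L2_u sum)
  finally show ?thesis unfolding L2_err .
qed

end
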